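(* For any noise level $\eta\ge1$, any positive integers $d$, $m$, $(d_u,T_u)_{u=1}^m$ and integer $B$ satisfying $d_u\le T_u$ for all $u\in[m]$, $\sum_{u=1}^m d_u\le d$, and $B\ge\sum_{u=1}^m d_u$, with $T=\sum_u T_u$, there exists an oblivious adversary such that: 1. it uses a ground truth $\theta^*\in\mathbb{R}^d$ with $\|\theta^*\|_2\le\sqrt d$ and $|\langle\theta^*,x_t\rangle|\le1$ for all $t$, and the noises $\xi_t=y_t-\langle\theta^*,x_t\rangle$ are independent zero-mean sub-Gaussian with variance proxy $\eta^2$; 2. it shows a sequence $x_1,\dots,x_T$ with $\|x_t\|_2\le1$ such that $[T]$ can be partitioned into disjoint nonempty sets $I_1,\dots,I_m$ with $|I_u|=T_u$ and $\{x_t:t\in I_u\}$ lying in a subspace of dimension $d_u$; 3. every online active learning algorithm whose expected number of label queries is at most $B$ has expected regret $\mathbb{E}[R]\ge c\,\big(\sum_{u=1}^m\sqrt{d_uT_u}\big)^2/B$, where $c>0$ is an absolute constant.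
   Context: Online active regression protocol: an oblivious adversary fixes $\theta^*\in\mathbb{R}^d$ and inputs $x_1,\dots,x_T$ in advance; labels are $y_t=\langle\theta^*,x_t\rangle+\xi_t$ with independent zero-mean noise. At each round the learner sees $x_t$, predicts $\hat y_t$ (using only previously observed information), and then decides whether to query ($q_t\in\{0,1\}$); if $q_t=1$ it observes $y_t$. Regret: $R=\sum_{t=1}^T(\hat y_t-\langle\theta^*,x_t\rangle)^2$; number of queries $Q=\sum_t q_t$.
   Formalization: The oblivious adversary draws the ground truth and inputs at random before play, independently of the learner, and expectations include this draw: for one fixed ground truth, the algorithm that always predicts its inner product with the input has zero regret with no queries. *)

theory Defs
  imports "HOL-Probability.Probability"
begin

text \<open>Vectors of R^d are represented as functions nat => real; only the
coordinates i < d are meaningful and the others are required to be 0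
wherever a vector is asserted to lie in R^d.\<close>

definition in_Rd :: "nat \<Rightarrow> (nat \<Rightarrow> real) \<Rightarrow> bool" where
  "in_Rd d x \<longleftrightarrow> (\<forall>i\<ge>d. x i = 0)"

definition inner_d :: "nat \<Rightarrow> (nat \<Rightarrow> real) \<Rightarrow> (nat \<Rightarrow> real) \<Rightarrow> real" where
  "inner_d d a b = (\<Sum>i<d. a i * b i)"

definition norm_d :: "nat \<Rightarrow> (nat \<Rightarrow> real) \<Rightarrow> real" where
  "norm_d d a = sqrt (\<Sum>i<d. (a i)\<^sup>2)"

definition in_subspace_of_dim :: "nat \<Rightarrow> nat \<Rightarrow> (nat \<Rightarrow> real) set \<Rightarrow> bool" where
  "in_subspace_of_dim d k S \<longleftrightarrow>
     (\<exists>b :: nat \<Rightarrow> nat \<Rightarrow> real.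
        (\<forall>j<k. in_Rd d (b j)) \<and>
        (\<forall>a :: nat \<Rightarrow> real. (\<forall>i. (\<Sum>j<k. a j * b j i) = 0) \<longrightarrow> (\<forall>j<k. a j = 0)) \<and>
        (\<forall>x\<in>S. \<exists>a :: nat \<Rightarrow> real. \<forall>i. x i = (\<Sum>j<k. a j * b j i)))"

definition subgaussian :: "real measure \<Rightarrow> real \<Rightarrow> bool" where
  "subgaussian N \<sigma> \<longleftrightarrow> prob_space N \<and> sets N = sets borel \<and>
     integrable N (\<lambda>x. x) \<and> (\<integral>x. x \<partial>N) = 0 \<and>
     (\<forall>l::real. integrable N (\<lambda>x. exp (l * x)) \<and>
        (\<integral>x. exp (l * x) \<partial>N) \<le> exp (l\<^sup>2 * \<sigma>\<^sup>2 / 2))"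

text \<open>Learner's observation history: past inputs together with the label if it
was queried.\<close>
type_synonym history = "((nat \<Rightarrow> real) \<times> real option) list"

text \<open>A (randomized) learner is given by a random seed r :: real and two maps:
  pred r t h x  -- the prediction at round t (rounds 0..T-1), from the history h
                   of previous rounds and the current input x;
  qry r t h x   -- whether to query the label at round t.
hist_of computes the history before round t, given inputs X and labels Y.\<close>
fun hist_of :: "(real \<Rightarrow> nat \<Rightarrow> history \<Rightarrow> (nat \<Rightarrow> real) \<Rightarrow> bool) \<Rightarrow> real \<Rightarrow>
    (nat \<Rightarrow> nat \<Rightarrow> real) \<Rightarrow> (nat \<Rightarrow> real) \<Rightarrow> nat \<Rightarrow> history" where
  "hist_of qry r X Y 0 = []"
| "hist_of qry r X Y (Suc t) = hist_of qry r X Y t @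
     [(X t, if qry r t (hist_of qry r X Y t) (X t) then Some (Y t) else None)]"

definition regret :: "nat \<Rightarrow> nat \<Rightarrow> (real \<Rightarrow> nat \<Rightarrow> history \<Rightarrow> (nat \<Rightarrow> real) \<Rightarrow> real) \<Rightarrow>
    (real \<Rightarrow> nat \<Rightarrow> history \<Rightarrow> (nat \<Rightarrow> real) \<Rightarrow> bool) \<Rightarrow> real \<Rightarrow>
    (nat \<Rightarrow> real) \<Rightarrow> (nat \<Rightarrow> nat \<Rightarrow> real) \<Rightarrow> (nat \<Rightarrow> real) \<Rightarrow> real" where
  "regret d T pred qry r \<theta> X Y =
     (\<Sum>t<T. (pred r t (hist_of qry r X Y t) (X t) - inner_d d \<theta> (X t))\<^sup>2)"

definition nqueries :: "nat \<Rightarrow> (real \<Rightarrow> nat \<Rightarrow> history \<Rightarrow> (nat \<Rightarrow> real) \<Rightarrow> bool) \<Rightarrow> real \<Rightarrow>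
    (nat \<Rightarrow> nat \<Rightarrow> real) \<Rightarrow> (nat \<Rightarrow> real) \<Rightarrow> nat" where
  "nqueries T qry r X Y = card {t. t < T \<and> qry r t (hist_of qry r X Y t) (X t)}"

definition labels :: "nat \<Rightarrow> (nat \<Rightarrow> real) \<Rightarrow> (nat \<Rightarrow> nat \<Rightarrow> real) \<Rightarrow> (nat \<Rightarrow> real) \<Rightarrow> nat \<Rightarrow> real" where
  "labels d \<theta> X \<xi> t = inner_d d \<theta> (X t) + \<xi> t"

text \<open>Joint probability space: oblivious adversary randomness A over (theta*, X),
independent noises N t for t < T, independent learner seed R.\<close>
definition joint :: "((nat \<Rightarrow> real) \<times> (nat \<Rightarrow> nat \<Rightarrow> real)) measure \<Rightarrow> nat \<Rightarrow>
    (nat \<Rightarrow> real measure) \<Rightarrow> real measure \<Rightarrow>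
    (((nat \<Rightarrow> real) \<times> (nat \<Rightarrow> nat \<Rightarrow> real)) \<times> (nat \<Rightarrow> real) \<times> real) measure" where
  "joint A T N R = A \<Otimes>\<^sub>M (PiM {..<T} N \<Otimes>\<^sub>M R)"

definition exp_regret where
  "exp_regret d T A N R pred qry =
     (\<integral>\<^sup>+ z. ennreal (case z of ((\<theta>, X), (\<xi>, r)) \<Rightarrow> regret d T pred qry r \<theta> X (labels d \<theta> X \<xi>))
        \<partial>joint A T N R)"

definition exp_queries where
  "exp_queries d T A N R qry =
     (\<integral>\<^sup>+ z. ennreal (case z of ((\<theta>, X), (\<xi>, r)) \<Rightarrow> real (nqueries T qry r X (labels d \<theta> X \<xi>)))
        \<partial>joint A T N R)"

text \<open>Measurability of the interaction (needed for the expectations to be meaningful).\<close>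
definition measurable_learner where
  "measurable_learner d T A N R pred qry \<longleftrightarrow>
     (\<lambda>z. case z of ((\<theta>, X), (\<xi>, r)) \<Rightarrow> regret d T pred qry r \<theta> X (labels d \<theta> X \<xi>))
        \<in> borel_measurable (joint A T N R) \<and>
     (\<lambda>z. case z of ((\<theta>, X), (\<xi>, r)) \<Rightarrow> real (nqueries T qry r X (labels d \<theta> X \<xi>)))
        \<in> borel_measurable (joint A T N R)"

end

theory Submission
  imports Defs
begin

text \<open>
  Each input is one of \<open>D = \<Sum>u<m. dU u\<close> standard basis vectors, and coordinate \<open>i\<close> of block \<open>u\<close>
  is shown \<open>v i \<ge> TU u / (2 * dU u)\<close> times. The ground truth has independent uniform signs,
  \<open>\<theta> i = \<plusminus> 1 / sqrt (K i)\<close>, and the noise is a centred binomial law on a lattice adapted to \<open>K i\<close>,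
  for which the Hellinger affinity between the two label laws of coordinate \<open>i\<close> is at least
  \<open>1 - 1 / K i\<close>.

  Fix the learner's seed. The affinity between the two laws of the history drops by at most
  \<open>1 / K i\<close> per expected query of coordinate \<open>i\<close>, so the Bayes risk of that coordinate is at least
  \<open>v i / K i * (1 - 2 * q i / K i)\<close>, with \<open>q i\<close> the expected number of its queries. Choosing \<open>K i\<close>
  proportional to \<open>B * sqrt (v i) / (\<Sum>j<D. sqrt (v j))\<close> makes \<open>v i / (K i)\<^sup>2\<close> bounded by a
  constant \<open>\<kappa>\<close>. Regret plus \<open>2 * \<kappa>\<close> times the number of queries is therefore bounded below for
  every seed; being linear, this bound survives integration over the seed.
\<close>

section \<open>Hellinger affinity\<close>

text \<open>The sum makes sense only if \<open>p\<close> has finite support.\<close>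

definition hellinger_affinity :: "'a pmf \<Rightarrow> 'a pmf \<Rightarrow> real" where
  "hellinger_affinity p q = (\<Sum>x\<in>set_pmf p. sqrt (pmf p x * pmf q x))"

lemma hellinger_affinity_self:
  "finite (set_pmf p) \<Longrightarrow> hellinger_affinity p p = 1"
  by (simp add: hellinger_affinity_def sum_pmf_eq_1)

lemma hellinger_affinity_map_inj:
  assumes "inj f"
  shows "hellinger_affinity (map_pmf f p) (map_pmf f q) = hellinger_affinity p q"
  unfolding hellinger_affinity_def set_map_pmf
  using assms by (subst sum.reindex) (auto simp: pmf_map_inj' intro: inj_on_subset)

abbreviation extend_pmf :: "('a \<Rightarrow> 'b \<Rightarrow> 'c) \<Rightarrow> 'a pmf \<Rightarrow> ('a \<Rightarrow> 'b pmf) \<Rightarrow> 'c pmf" where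
  "extend_pmf C p f \<equiv> bind_pmf p (\<lambda>x. map_pmf (C x) (f x))"

lemma pmf_extend_pmf:
  assumes "inj (case_prod C)"
  shows "pmf (extend_pmf C p f) (C x y) = pmf p x * pmf (f x) y"
proof -
  have C_eq_iff: "C x y = C x' y' \<longleftrightarrow> x = x' \<and> y = y'" for x y x' y'
    using assms by (auto dest: injD[of _ "(x, y)" "(x', y')"])
  have "pmf (map_pmf (C x') (f x')) (C x y) = pmf (f x) y * indicator {x} x'" for x'
  proof (cases "x' = x")
    case True
    then show ?thesis by (simp add: pmf_map_inj' inj_def C_eq_iff)
  next
    case False
    then show ?thesis by (auto simp: pmf_eq_0_set_pmf C_eq_iff)
  qed
  then show ?thesis
    by (simp only: pmf_bind) (simp add: measure_pmf_single mult.commute)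
qed

lemma hellinger_affinity_extend_pmf:
  assumes inj_C: "inj (case_prod C)"
    and "finite (set_pmf p)" "\<And>x. x \<in> set_pmf p \<Longrightarrow> finite (set_pmf (f x))"
  shows "hellinger_affinity (extend_pmf C p f) (extend_pmf C q g) =
    (\<Sum>x\<in>set_pmf p. sqrt (pmf p x * pmf q x) * hellinger_affinity (f x) (g x))"
proof -
  let ?P = "extend_pmf C p f" and ?Q = "extend_pmf C q g"
  let ?S = "SIGMA x:set_pmf p. set_pmf (f x)"
  have "set_pmf ?P = case_prod C ` ?S"
    by auto
  then have "hellinger_affinity ?P ?Q =
      (\<Sum>(x, y)\<in>?S. sqrt (pmf ?P (C x y) * pmf ?Q (C x y)))"
    unfolding hellinger_affinity_def using inj_C
    by (simp add: sum.reindex inj_on_subset case_prod_unfold)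
  also have "\<dots> = (\<Sum>(x, y)\<in>?S. sqrt (pmf p x * pmf q x) * sqrt (pmf (f x) y * pmf (g x) y))"
    by (simp add: pmf_extend_pmf[OF inj_C] real_sqrt_mult mult_ac)
  also have "\<dots> = (\<Sum>x\<in>set_pmf p. sqrt (pmf p x * pmf q x) * hellinger_affinity (f x) (g x))"
    using assms by (simp add: sum.Sigma[symmetric] hellinger_affinity_def sum_distrib_left)
  finally show ?thesis .
qed

lemma hellinger_affinity_extend_pmf_ge:
  assumes inj_C: "inj (case_prod C)" and fin: "finite (set_pmf p)" "finite (set_pmf q)"
      "\<And>x. x \<in> set_pmf p \<Longrightarrow> finite (set_pmf (f x))"
    and loss: "\<And>x. 0 \<le> \<delta> x" "\<And>x. x \<in> set_pmf p \<Longrightarrow> 1 - \<delta> x \<le> hellinger_affinity (f x) (g x)"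
  shows "hellinger_affinity p q - (measure_pmf.expectation p \<delta> + measure_pmf.expectation q \<delta>) / 2 \<le>
    hellinger_affinity (extend_pmf C p f) (extend_pmf C q g)" (is "_ - ?loss / 2 \<le> _")
proof -
  let ?w = "\<lambda>x. sqrt (pmf p x * pmf q x)"
  have "measure_pmf.expectation p \<delta> = (\<Sum>x\<in>set_pmf p. pmf p x * \<delta> x)"
    using fin by (simp add: integral_measure_pmf[of "set_pmf p"])
  moreover have "(\<Sum>x\<in>set_pmf p. pmf q x * \<delta> x) \<le> (\<Sum>x\<in>set_pmf p \<union> set_pmf q. pmf q x * \<delta> x)"
    using fin loss by (intro sum_mono2) auto
  moreover have "\<dots> = measure_pmf.expectation q \<delta>"
    using fin by (simp add: integral_measure_pmf[of "set_pmf p \<union> set_pmf q"])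
  ultimately have "hellinger_affinity p q - ?loss / 2 \<le>
      (\<Sum>x\<in>set_pmf p. ?w x - (pmf p x + pmf q x) / 2 * \<delta> x)"
    by (simp add: hellinger_affinity_def sum_subtractf sum.distrib sum_divide_distrib[symmetric]
        distrib_right add_divide_distrib)
  also have "\<dots> \<le> (\<Sum>x\<in>set_pmf p. ?w x * hellinger_affinity (f x) (g x))"
  proof (intro sum_mono)
    fix x assume "x \<in> set_pmf p"
    have "?w x * \<delta> x \<le> (pmf p x + pmf q x) / 2 * \<delta> x"
      using loss by (intro mult_right_mono arith_geo_mean_sqrt) auto
    moreover have "?w x * (1 - \<delta> x) \<le> ?w x * hellinger_affinity (f x) (g x)"
      using \<open>x \<in> set_pmf p\<close> loss by (intro mult_left_mono) auto
    ultimately show "?w x - (pmf p x + pmf q x) / 2 * \<delta> x \<le> ?w x * hellinger_affinity (f x) (g x)"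
      by (simp add: right_diff_distrib)
  qed
  also have "\<dots> = hellinger_affinity (extend_pmf C p f) (extend_pmf C q g)"
    by (rule hellinger_affinity_extend_pmf[OF inj_C, symmetric]) (use fin in auto)
  finally show ?thesis .
qed

lemma weighted_squared_errors_ge:
  fixes u v a b z :: real
  assumes "0 \<le> u" "0 \<le> v"
  shows "((a - b) / 2)\<^sup>2 * (4 * sqrt (u * v) - u - v) \<le> u * (z - a)\<^sup>2 + v * (z - b)\<^sup>2"
proof -
  define \<alpha> \<beta> e w where "\<alpha> = sqrt u" and "\<beta> = sqrt v" and "e = (a - b) / 2" and "w = z - (a + b) / 2"
  have weights: "u = \<alpha>\<^sup>2" "v = \<beta>\<^sup>2" and sqrt_weights: "sqrt (u * v) = \<alpha> * \<beta>"
    and errors: "z - a = w - e" "z - b = w + e"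
    using assms by (simp_all add: \<alpha>_def \<beta>_def e_def w_def real_sqrt_mult field_simps)
  have "u * (z - a)\<^sup>2 + v * (z - b)\<^sup>2 - e\<^sup>2 * (4 * sqrt (u * v) - u - v) =
      ((\<alpha> - \<beta>) * w)\<^sup>2 / 2 + ((\<alpha> + \<beta>) * w - 2 * e * (\<alpha> - \<beta>))\<^sup>2 / 2"
    unfolding sqrt_weights errors unfolding weights by (simp add: power2_eq_square field_simps)
  moreover have "\<dots> \<ge> 0"
    by simp
  ultimately show ?thesis
    unfolding e_def by linarith
qed

lemma two_point_squared_error_ge:
  assumes fin: "finite (set_pmf p)" "finite (set_pmf q)"
  shows "((a - b) / 2)\<^sup>2 * (4 * hellinger_affinity p q - 2) \<le>
    measure_pmf.expectation p (\<lambda>x. (g x - a)\<^sup>2) + measure_pmf.expectation q (\<lambda>x. (g x - b)\<^sup>2)"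
proof -
  let ?S = "set_pmf p \<union> set_pmf q"
  have "hellinger_affinity p q = (\<Sum>x\<in>?S. sqrt (pmf p x * pmf q x))"
    unfolding hellinger_affinity_def using fin
    by (intro sum.mono_neutral_left) (auto simp: set_pmf_iff)
  moreover have "(\<Sum>x\<in>?S. pmf p x) = 1" "(\<Sum>x\<in>?S. pmf q x) = 1"
    using fin by (auto intro!: sum_pmf_eq_1)
  ultimately have "((a - b) / 2)\<^sup>2 * (4 * hellinger_affinity p q - 2) =
      (\<Sum>x\<in>?S. ((a - b) / 2)\<^sup>2 * (4 * sqrt (pmf p x * pmf q x) - pmf p x - pmf q x))"
    by (simp add: sum_distrib_left[symmetric] sum_subtractf)
  also have "\<dots> \<le> (\<Sum>x\<in>?S. pmf p x * (g x - a)\<^sup>2 + pmf q x * (g x - b)\<^sup>2)"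
    by (intro sum_mono weighted_squared_errors_ge) auto
  also have "\<dots> = measure_pmf.expectation p (\<lambda>x. (g x - a)\<^sup>2) +
      measure_pmf.expectation q (\<lambda>x. (g x - b)\<^sup>2)"
    using fin by (simp add: sum.distrib integral_measure_pmf[of ?S])
  finally show ?thesis .
qed

section \<open>The law of the history\<close>

lemma expectation_bind_pmf_finite:
  fixes h :: "'b \<Rightarrow> real"
  assumes "finite (set_pmf p)" "\<And>x. x \<in> set_pmf p \<Longrightarrow> finite (set_pmf (f x))"
  shows "measure_pmf.expectation (bind_pmf p f) h =
    measure_pmf.expectation p (\<lambda>x. measure_pmf.expectation (f x) h)"
  using assms
  by (simp add: pmf_expectation_bind[of "set_pmf p"] integral_measure_pmf[of "set_pmf p"])

lemma finite_set_Pi_pmf: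
  "finite I \<Longrightarrow> (\<And>i. finite (set_pmf (p i))) \<Longrightarrow> finite (set_pmf (Pi_pmf I dflt p))"
  by (simp add: set_Pi_pmf finite_PiE_dflt)

definition queries_in :: "nat set \<Rightarrow> history \<Rightarrow> nat" where
  "queries_in S h = card {s \<in> S. s < length h \<and> snd (h ! s) \<noteq> None}"

lemma queries_in_Nil [simp]: "queries_in S [] = 0"
  by (simp add: queries_in_def)

lemma queries_in_snoc:
  "queries_in S (h @ [z]) = queries_in S h + (if length h \<in> S \<and> snd z \<noteq> None then 1 else 0)"
proof -
  have "{s \<in> S. s < length (h @ [z]) \<and> snd ((h @ [z]) ! s) \<noteq> None} =
      (if length h \<in> S \<and> snd z \<noteq> None then insert (length h) else id)
      {s \<in> S. s < length h \<and> snd (h ! s) \<noteq> None}"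
    by (auto simp: nth_append less_Suc_eq)
  then show ?thesis
    by (simp add: queries_in_def)
qed

lemma sum_queries_in_fibres:
  assumes "c ` S \<subseteq> I" "finite S" "finite I"
  shows "(\<Sum>i\<in>I. queries_in {s \<in> S. c s = i} h) = queries_in S h"
proof -
  let ?Q = "{s \<in> S. s < length h \<and> snd (h ! s) \<noteq> None}"
  have "(\<Sum>i\<in>I. card {s \<in> ?Q. c s = i}) = card ?Q"
    unfolding card_eq_sum by (rule sum.group) (use assms in auto)
  then show ?thesis
    by (simp add: queries_in_def conj_ac)
qed

lemma length_hist_of [simp]: "length (hist_of qry r X Y t) = t"
  by (induction t) auto

lemma take_hist_of: "t \<le> T \<Longrightarrow> take t (hist_of qry r X Y T) = hist_of qry r X Y t"
  by (induction T) (auto simp: le_Suc_eq)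

lemma hist_of_cong: "(\<And>s. s < t \<Longrightarrow> Y s = Y' s) \<Longrightarrow> hist_of qry r X Y t = hist_of qry r X Y' t"
  by (induction t) auto

lemma snd_nth_hist_of:
  "s < t \<Longrightarrow> snd (hist_of qry r X Y t ! s) =
    (if qry r s (hist_of qry r X Y s) (X s) then Some (Y s) else None)"
  by (induction t) (auto simp: nth_append less_Suc_eq)

lemma nqueries_eq_queries_in:
  "nqueries T qry r X Y = queries_in {..<T} (hist_of qry r X Y T)"
  unfolding nqueries_def queries_in_def
  by (rule arg_cong[of _ _ card]) (auto simp: snd_nth_hist_of split: if_splits)

text \<open>A label that is not queried is not drawn, so it cannot lower the affinity of two laws.\<close>

primrec history_pmf :: "(real \<Rightarrow> nat \<Rightarrow> history \<Rightarrow> (nat \<Rightarrow> real) \<Rightarrow> bool) \<Rightarrow> real \<Rightarrow>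
    (nat \<Rightarrow> nat \<Rightarrow> real) \<Rightarrow> (nat \<Rightarrow> real pmf) \<Rightarrow> nat \<Rightarrow> history pmf" where
  "history_pmf qry r X L 0 = return_pmf []"
| "history_pmf qry r X L (Suc t) = extend_pmf (\<lambda>h z. h @ [(X t, z)]) (history_pmf qry r X L t)
     (\<lambda>h. if qry r t h (X t) then map_pmf Some (L t) else return_pmf None)"

lemma length_history_pmf: "h \<in> set_pmf (history_pmf qry r X L t) \<Longrightarrow> length h = t"
  by (induction t arbitrary: h) auto

lemma finite_set_history_pmf:
  "(\<And>s. s < t \<Longrightarrow> finite (set_pmf (L s))) \<Longrightarrow> finite (set_pmf (history_pmf qry r X L t))"
  by (induction t) auto

lemma map_hist_of_Pi_pmf:
  "map_pmf (\<lambda>\<xi>. hist_of qry r X (\<lambda>t. F t (\<xi> t)) t) (Pi_pmf {..<t} dflt N) =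
    history_pmf qry r X (\<lambda>t. map_pmf (F t) (N t)) t"
proof (induction t)
  case (Suc t)
  let ?H = "\<lambda>\<xi>. hist_of qry r X (\<lambda>t. F t (\<xi> t))"
  have hist_upd: "?H (\<xi>(t := y)) t = ?H \<xi> t" for \<xi> y
    by (rule hist_of_cong) simp
  have "map_pmf (\<lambda>\<xi>. ?H \<xi> (Suc t)) (Pi_pmf {..<Suc t} dflt N) =
      bind_pmf (Pi_pmf {..<t} dflt N) (\<lambda>\<xi>. map_pmf (\<lambda>y. ?H (\<xi>(t := y)) (Suc t)) (N t))"
    unfolding lessThan_Suc
    by (simp add: Pi_pmf_insert' bind_commute_pmf[of "N t" "Pi_pmf {..<t} dflt N"] map_bind_pmf
        map_pmf_def bind_assoc_pmf bind_return_pmf del: fun_upd_apply hist_of.simps)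
  also have "\<dots> = extend_pmf (\<lambda>\<xi> z. ?H \<xi> t @ [(X t, z)]) (Pi_pmf {..<t} dflt N)
      (\<lambda>\<xi>. if qry r t (?H \<xi> t) (X t) then map_pmf Some (map_pmf (F t) (N t)) else return_pmf None)"
    by (intro bind_pmf_cong refl)
      (simp add: hist_upd pmf.map_comp o_def map_pmf_const fun_upd_same del: fun_upd_apply)
  also have "\<dots> = history_pmf qry r X (\<lambda>t. map_pmf (F t) (N t)) (Suc t)"
    by (simp add: Suc.IH[symmetric] bind_map_pmf)
  finally show ?case .
qed simp

lemma expectation_queries_in_Suc:
  fixes qry r X L t S
  defines "H \<equiv> history_pmf qry r X L"
  assumes fin: "\<And>s. s \<le> t \<Longrightarrow> finite (set_pmf (L s))"
  shows "measure_pmf.expectation (H (Suc t)) (\<lambda>h. real (queries_in S h)) =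
    measure_pmf.expectation (H t) (\<lambda>h. real (queries_in S h)) +
    measure_pmf.expectation (H t) (\<lambda>h. if t \<in> S \<and> qry r t h (X t) then 1 else 0)"
proof -
  have fin_H: "finite (set_pmf (H t))"
    unfolding H_def using fin by (intro finite_set_history_pmf) auto
  have "measure_pmf.expectation (H (Suc t)) (\<lambda>h. real (queries_in S h)) =
      measure_pmf.expectation (H t)
        (\<lambda>h. real (queries_in S h) + (if t \<in> S \<and> qry r t h (X t) then 1 else 0))"
    using fin_H unfolding H_def history_pmf.simps
    by (subst expectation_bind_pmf_finite)
      (auto simp: fin queries_in_snoc AE_measure_pmf_iff length_history_pmf intro!: integral_cong_AE)
  then show ?thesis
    using fin_H by (simp add: integrable_measure_pmf_finite)
qed

lemma hellinger_affinity_history_pmf_ge: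
  assumes fin: "\<And>s. s < t \<Longrightarrow> finite (set_pmf (L s))" "\<And>s. s < t \<Longrightarrow> finite (set_pmf (L' s))"
    and outside: "\<And>s. s < t \<Longrightarrow> s \<notin> S \<Longrightarrow> L s = L' s"
    and inside: "\<And>s. s < t \<Longrightarrow> s \<in> S \<Longrightarrow> 1 - \<delta> \<le> hellinger_affinity (L s) (L' s)"
    and "0 \<le> \<delta>"
  shows "1 - \<delta> / 2 * (measure_pmf.expectation (history_pmf qry r X L t) (\<lambda>h. real (queries_in S h)) +
      measure_pmf.expectation (history_pmf qry r X L' t) (\<lambda>h. real (queries_in S h)))
    \<le> hellinger_affinity (history_pmf qry r X L t) (history_pmf qry r X L' t)"
  using fin outside inside
proof (induction t)
  case 0
  then show ?case by (simp add: hellinger_affinity_self)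
next
  case (Suc t)
  let ?P = "history_pmf qry r X L t" and ?P' = "history_pmf qry r X L' t"
  let ?Q = "\<lambda>h. real (queries_in S h)"
  let ?I = "\<lambda>h. if t \<in> S \<and> qry r t h (X t) then 1 else (0::real)"
  have fin: "finite (set_pmf ?P)" "finite (set_pmf ?P')" "finite (set_pmf (L t))"
    using Suc.prems by (auto intro!: finite_set_history_pmf)
  have "hellinger_affinity ?P ?P' -
      (measure_pmf.expectation ?P (\<lambda>h. \<delta> * ?I h) + measure_pmf.expectation ?P' (\<lambda>h. \<delta> * ?I h)) / 2 \<le>
      hellinger_affinity (history_pmf qry r X L (Suc t)) (history_pmf qry r X L' (Suc t))"
    unfolding history_pmf.simps
  proof (rule hellinger_affinity_extend_pmf_ge)
    show "inj (\<lambda>(h, z). h @ [(X t, z)])"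
      by (auto simp: inj_def)
    fix h
    show "1 - \<delta> * ?I h \<le> hellinger_affinity
        (if qry r t h (X t) then map_pmf Some (L t) else return_pmf None)
        (if qry r t h (X t) then map_pmf Some (L' t) else return_pmf None)"
      using Suc.prems(3,4)[of t] fin
      by (cases "t \<in> S") (auto simp: hellinger_affinity_map_inj hellinger_affinity_self)
  qed (use fin \<open>0 \<le> \<delta>\<close> in auto)
  moreover have "1 - \<delta> / 2 * (measure_pmf.expectation ?P ?Q + measure_pmf.expectation ?P' ?Q)
      \<le> hellinger_affinity ?P ?P'"
    using Suc by auto
  ultimately show ?case
    using Suc.prems(1,2)
    by (simp add: expectation_queries_in_Suc less_Suc_eq_le field_simps del: history_pmf.simps)
qed

section \<open>Bayes risk of random signs\<close>

lemma sum_Pow_remove: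
  fixes f :: "'a set \<Rightarrow> 'b::comm_monoid_add"
  assumes "finite S" "i \<in> S"
  shows "(\<Sum>J\<in>Pow S. f J) = (\<Sum>J\<in>Pow (S - {i}). f (insert i J) + f J)"
proof -
  have "Pow S = Pow (S - {i}) \<union> insert i ` Pow (S - {i})"
    using Pow_insert[of i "S - {i}"] assms by (simp add: insert_absorb)
  then have "(\<Sum>J\<in>Pow S. f J) = (\<Sum>J\<in>Pow (S - {i}). f J) + (\<Sum>J\<in>insert i ` Pow (S - {i}). f J)"
    using assms by (simp only:) (rule sum.union_disjoint, auto)
  also have "(\<Sum>J\<in>insert i ` Pow (S - {i}). f J) = (\<Sum>J\<in>Pow (S - {i}). f (insert i J))"
    by (subst sum.reindex) (auto simp: inj_on_def)
  finally show ?thesis by (simp add: sum.distrib add.commute)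
qed

lemma expectation_pmf_of_set_Pow_flip:
  fixes f :: "'a set \<Rightarrow> real"
  assumes "finite S" "i \<in> S"
  shows "measure_pmf.expectation (pmf_of_set (Pow S)) f =
    measure_pmf.expectation (pmf_of_set (Pow S)) (\<lambda>J. (f (insert i J) + f (J - {i})) / 2)"
proof -
  have "(\<Sum>J\<in>Pow S. (f (insert i J) + f (J - {i})) / 2) = (\<Sum>J\<in>Pow S. f J)"
    using assms by (subst (1 2) sum_Pow_remove[where i = i])
      (auto intro!: sum.cong simp: insert_absorb subset_Diff_insert)
  then show ?thesis
    using assms by (subst (1 2) integral_pmf_of_set) auto
qed

definition basis_vec :: "nat \<Rightarrow> nat \<Rightarrow> real" where
  "basis_vec j = (\<lambda>i. if i = j then 1 else 0)"

lemma inner_d_basis_vec: "j < d \<Longrightarrow> inner_d d v (basis_vec j) = v j"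
  by (simp add: inner_d_def basis_vec_def if_distrib cong: if_cong)

lemma norm_d_basis_vec_le: "norm_d d (basis_vec j) \<le> 1"
  by (simp add: norm_d_def basis_vec_def if_distrib[of "\<lambda>x. x\<^sup>2"] cong: if_cong)

lemma in_Rd_basis_vec: "j < d \<Longrightarrow> in_Rd d (basis_vec j)"
  by (auto simp: in_Rd_def basis_vec_def)

definition sign_vec :: "nat \<Rightarrow> (nat \<Rightarrow> real) \<Rightarrow> nat set \<Rightarrow> nat \<Rightarrow> real" where
  "sign_vec D a J i = (if i < D then if i \<in> J then a i else - a i else 0)"

locale sign_design =
  fixes d D T :: nat and c :: "nat \<Rightarrow> nat" and a \<delta> :: "nat \<Rightarrow> real" and noise :: "nat \<Rightarrow> real pmf"
  assumes D_le: "D \<le> d" and c_less: "t < T \<Longrightarrow> c t < D"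
    and finite_noise: "finite (set_pmf (noise i))" and abs_a_le: "\<bar>a i\<bar> \<le> 1" and \<delta>_nonneg: "0 \<le> \<delta> i"
    and affinity_ge: "1 - \<delta> i \<le>
      hellinger_affinity (map_pmf ((+) (a i)) (noise i)) (map_pmf ((+) (- a i)) (noise i))"
begin

definition rounds :: "nat \<Rightarrow> nat set" where
  "rounds i = {t \<in> {..<T}. c t = i}"

definition inputs :: "nat \<Rightarrow> nat \<Rightarrow> real" where
  "inputs t = basis_vec (c t)"

abbreviation prior :: "nat set pmf" where
  "prior \<equiv> pmf_of_set (Pow {..<D})"

lemma finite_prior: "finite (set_pmf prior)"
  by (subst set_pmf_of_set) auto

lemma inner_d_inputs: "t < T \<Longrightarrow> inner_d d v (inputs t) = v (c t)"
  unfolding inputs_def using c_less D_le by (intro inner_d_basis_vec) force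

lemma inner_d_sign_vec_inputs:
  "t < T \<Longrightarrow> inner_d d (sign_vec D a J) (inputs t) = (if c t \<in> J then a (c t) else - a (c t))"
  using c_less by (simp add: inner_d_inputs sign_vec_def)

context
  fixes pred :: "real \<Rightarrow> nat \<Rightarrow> history \<Rightarrow> (nat \<Rightarrow> real) \<Rightarrow> real"
    and qry :: "real \<Rightarrow> nat \<Rightarrow> history \<Rightarrow> (nat \<Rightarrow> real) \<Rightarrow> bool" and r :: real
begin

definition label_pmf :: "nat set \<Rightarrow> nat \<Rightarrow> real pmf" where
  "label_pmf J t = map_pmf ((+) (inner_d d (sign_vec D a J) (inputs t))) (noise (c t))"

abbreviation expect :: "nat set \<Rightarrow> (history \<Rightarrow> real) \<Rightarrow> real" where
  "expect J \<equiv> measure_pmf.expectation (history_pmf qry r inputs (label_pmf J) T)"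

abbreviation queries :: "nat set \<Rightarrow> nat \<Rightarrow> real" where
  "queries J i \<equiv> expect J (\<lambda>h. real (queries_in (rounds i) h))"

definition sq_err :: "nat set \<Rightarrow> nat \<Rightarrow> history \<Rightarrow> real" where
  "sq_err J t h = (pred r t (take t h) (inputs t) - inner_d d (sign_vec D a J) (inputs t))\<^sup>2"

definition risk :: "nat set \<Rightarrow> nat \<Rightarrow> real" where
  "risk J i = expect J (\<lambda>h. \<Sum>t\<in>rounds i. sq_err J t h)"

lemma finite_history: "finite (set_pmf (history_pmf qry r inputs (label_pmf J) T))"
  by (intro finite_set_history_pmf) (simp add: label_pmf_def finite_noise)

lemmas integrable_history = integrable_measure_pmf_finite[OF finite_history]

lemma risk_flip_sign_ge:
  assumes "i < D" "i \<notin> J"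
  shows "real (card (rounds i)) * (a i)\<^sup>2 * (2 - 2 * \<delta> i * (queries (insert i J) i + queries J i))
    \<le> risk (insert i J) i + risk J i" (is "_ * (2 - 2 * \<delta> i * ?q) \<le> _")
proof -
  let ?aff = "hellinger_affinity (history_pmf qry r inputs (label_pmf (insert i J)) T)
    (history_pmf qry r inputs (label_pmf J) T)"
  have "1 - \<delta> i / 2 * ?q \<le> ?aff"
  proof (rule hellinger_affinity_history_pmf_ge)
    fix s assume "s < T" "s \<in> rounds i"
    then show "1 - \<delta> i \<le> hellinger_affinity (label_pmf (insert i J) s) (label_pmf J s)"
      using affinity_ge[of i] assms by (simp add: label_pmf_def inner_d_sign_vec_inputs rounds_def)
  qed (auto simp: label_pmf_def inner_d_sign_vec_inputs rounds_def finite_noise \<delta>_nonneg)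
  then have "(a i)\<^sup>2 * (2 - 2 * \<delta> i * ?q) \<le> ((a i - - a i) / 2)\<^sup>2 * (4 * ?aff - 2)"
    by (simp add: mult_left_mono)
  also have "\<dots> \<le> expect (insert i J) (sq_err (insert i J) t) + expect J (sq_err J t)"
    if "t \<in> rounds i" for t
  proof -
    have "sq_err (insert i J) t = (\<lambda>h. (pred r t (take t h) (inputs t) - a i)\<^sup>2)"
      "sq_err J t = (\<lambda>h. (pred r t (take t h) (inputs t) - - a i)\<^sup>2)"
      using that assms by (simp_all add: fun_eq_iff sq_err_def inner_d_sign_vec_inputs rounds_def)
    then show ?thesis
      by (simp only: two_point_squared_error_ge finite_history)
  qed
  finally have "(\<Sum>t\<in>rounds i. (a i)\<^sup>2 * (2 - 2 * \<delta> i * ?q)) \<le>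
      (\<Sum>t\<in>rounds i. expect (insert i J) (sq_err (insert i J) t) + expect J (sq_err J t))"
    by (rule sum_mono)
  then show ?thesis
    by (simp add: risk_def sum.distrib integrable_history mult.assoc)
qed

lemma coordinate_bayes_risk_ge:
  assumes "i < D"
  shows "real (card (rounds i)) * (a i)\<^sup>2 *
      (1 - 2 * \<delta> i * measure_pmf.expectation prior (\<lambda>J. queries J i))
    \<le> measure_pmf.expectation prior (\<lambda>J. risk J i)"
proof -
  let ?q = "\<lambda>J. queries J i" and ?e = "\<lambda>J. risk J i" and ?n = "real (card (rounds i)) * (a i)\<^sup>2"
  have flip: "measure_pmf.expectation prior f =
      measure_pmf.expectation prior (\<lambda>J. (f (insert i J) + f (J - {i})) / 2)"
    for f :: "nat set \<Rightarrow> real"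
    using assms by (intro expectation_pmf_of_set_Pow_flip) auto
  have "?n * (1 - 2 * \<delta> i * measure_pmf.expectation prior ?q) =
      measure_pmf.expectation prior (\<lambda>J. ?n * (2 - 2 * \<delta> i * (?q (insert i J) + ?q (J - {i}))) / 2)"
    by (subst flip) (simp add: integrable_measure_pmf_finite finite_prior field_simps)
  also have "\<dots> \<le> measure_pmf.expectation prior (\<lambda>J. (?e (insert i J) + ?e (J - {i})) / 2)"
    using risk_flip_sign_ge[of i "J - {i}" for J] assms
    by (intro integral_mono integrable_measure_pmf_finite finite_prior divide_right_mono) auto
  also have "\<dots> = measure_pmf.expectation prior ?e"
    by (rule flip[symmetric])
  finally show ?thesis .
qed

lemma bayes_risk_ge:
  assumes loss_le: "\<And>i. i < D \<Longrightarrow> real (card (rounds i)) * (a i)\<^sup>2 * \<delta> i \<le> \<kappa>"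
  shows "(\<Sum>i<D. real (card (rounds i)) * (a i)\<^sup>2) \<le>
    measure_pmf.expectation prior
      (\<lambda>J. expect J (\<lambda>h. (\<Sum>t<T. sq_err J t h) + 2 * \<kappa> * real (queries_in {..<T} h)))"
proof -
  let ?q = "\<lambda>i. measure_pmf.expectation prior (\<lambda>J. queries J i)"
  let ?e = "\<lambda>i. measure_pmf.expectation prior (\<lambda>J. risk J i)"
  have "(\<Sum>i<D. real (card (rounds i)) * (a i)\<^sup>2) \<le> (\<Sum>i<D. ?e i + 2 * \<kappa> * ?q i)"
  proof (intro sum_mono)
    fix i assume "i \<in> {..<D}"
    then have "i < D" by simp
    have "0 \<le> ?q i"
      by simp
    then have "real (card (rounds i)) * (a i)\<^sup>2 * \<delta> i * ?q i \<le> \<kappa> * ?q i"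
      by (intro mult_right_mono loss_le \<open>i < D\<close>)
    then show "real (card (rounds i)) * (a i)\<^sup>2 \<le> ?e i + 2 * \<kappa> * ?q i"
      using coordinate_bayes_risk_ge[OF \<open>i < D\<close>] by (simp add: right_diff_distrib mult_ac)
  qed
  also have "\<dots> = measure_pmf.expectation prior (\<lambda>J. expect J (\<lambda>h.
      (\<Sum>i<D. \<Sum>t\<in>rounds i. sq_err J t h) + 2 * \<kappa> * (\<Sum>i<D. real (queries_in (rounds i) h))))"
    by (simp add: risk_def integrable_history integrable_measure_pmf_finite[OF finite_prior]
        sum.distrib sum_distrib_left)
  also have "\<dots> = measure_pmf.expectation prior (\<lambda>J. expect J (\<lambda>h.
      (\<Sum>t<T. sq_err J t h) + 2 * \<kappa> * real (queries_in {..<T} h)))"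
  proof -
    have c_range: "c ` {..<T} \<subseteq> {..<D}"
      using c_less by auto
    have "(\<Sum>i<D. \<Sum>t\<in>rounds i. sq_err J t h) = (\<Sum>t<T. sq_err J t h)" for J h
      unfolding rounds_def by (rule sum.group) (simp_all add: c_range)
    moreover have "(\<Sum>i<D. queries_in (rounds i) h) = queries_in {..<T} h" for h
      unfolding rounds_def by (rule sum_queries_in_fibres) (simp_all add: c_range)
    ultimately show ?thesis
      by (simp only: of_nat_sum[symmetric])
  qed
  finally show ?thesis .
qed

lemma bayes_risk_noise_ge:
  assumes "\<And>i. i < D \<Longrightarrow> real (card (rounds i)) * (a i)\<^sup>2 * \<delta> i \<le> \<kappa>"
  shows "(\<Sum>i<D. real (card (rounds i)) * (a i)\<^sup>2) \<le>
    measure_pmf.expectation (pair_pmf prior (Pi_pmf {..<T} dflt (\<lambda>t. noise (c t)))) (\<lambda>(J, \<xi>).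
      let \<theta> = sign_vec D a J; Y = labels d \<theta> inputs \<xi>
      in regret d T pred qry r \<theta> inputs Y + 2 * \<kappa> * real (nqueries T qry r inputs Y))"
proof -
  let ?\<Xi> = "Pi_pmf {..<T} dflt (\<lambda>t. noise (c t))"
  have "finite (set_pmf ?\<Xi>)"
    by (simp add: finite_set_Pi_pmf finite_noise)
  moreover have "history_pmf qry r inputs (label_pmf J) T =
      map_pmf (\<lambda>\<xi>. hist_of qry r inputs (labels d (sign_vec D a J) inputs \<xi>) T) ?\<Xi>" for J
    unfolding label_pmf_def labels_def[abs_def] by (rule map_hist_of_Pi_pmf[symmetric])
  moreover have "regret d T pred qry r (sign_vec D a J) inputs Y =
      (\<Sum>t<T. sq_err J t (hist_of qry r inputs Y T))" for J Y
    unfolding regret_def sq_err_def by (intro sum.cong) (simp_all add: take_hist_of)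
  ultimately show ?thesis
    using bayes_risk_ge[OF assms] finite_prior
    by (simp add: pair_pmf_def expectation_bind_pmf_finite nqueries_eq_queries_in Let_def)
qed

end
end

section \<open>Integration over the noise and the seed\<close>

abbreviation borel_of_pmf :: "'a::topological_space pmf \<Rightarrow> 'a measure" where
  "borel_of_pmf p \<equiv> distr (measure_pmf p) borel (\<lambda>x. x)"

lemma prob_space_borel_of_pmf: "prob_space (borel_of_pmf p)"
  by (rule prob_space.prob_space_distr[OF prob_space_measure_pmf]) simp

lemma nn_integral_measure_pmf_commute:
  assumes "finite (set_pmf p)" "\<And>x. x \<in> set_pmf p \<Longrightarrow> f x \<in> borel_measurable M"
  shows "(\<integral>\<^sup>+x. \<integral>\<^sup>+y. f x y \<partial>M \<partial>measure_pmf p) = (\<integral>\<^sup>+y. \<integral>\<^sup>+x. f x y \<partial>measure_pmf p \<partial>M)"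
  using assms by (simp add: nn_integral_measure_pmf_finite nn_integral_sum nn_integral_multc)

lemma PiM_borel_of_pmf:
  fixes p :: "'i \<Rightarrow> 'a::topological_space pmf"
  assumes "finite I"
  shows "distr (measure_pmf (Pi_pmf I undefined p)) (PiM I (\<lambda>_. borel)) (\<lambda>f. restrict f I) =
    PiM I (\<lambda>i. borel_of_pmf (p i))"
    (is "?D = _")
proof -
  interpret product_sigma_finite "\<lambda>i. borel_of_pmf (p i)"
    by (simp add: product_sigma_finite_def prob_space_borel_of_pmf prob_space_imp_sigma_finite)
  show ?thesis
  proof (rule PiM_eqI[OF \<open>finite I\<close>])
    fix A assume meas_A: "\<And>i. i \<in> I \<Longrightarrow> A i \<in> sets (borel_of_pmf (p i))"
    have "(\<lambda>f. restrict f I) -` PiE I A = Pi I A"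
      by (auto simp: PiE_def Pi_def)
    then have "emeasure ?D (PiE I A) = emeasure (measure_pmf (Pi_pmf I undefined p)) (Pi I A)"
      using meas_A \<open>finite I\<close> by (subst emeasure_distr) (auto intro!: sets_PiM_I_finite simp: space_PiM)
    also have "\<dots> = (\<Prod>i\<in>I. emeasure (measure_pmf (p i)) (A i))"
      using \<open>finite I\<close> by (simp add: measure_pmf.emeasure_eq_measure measure_Pi_pmf_Pi prod_ennreal)
    also have "\<dots> = (\<Prod>i\<in>I. emeasure (borel_of_pmf (p i)) (A i))"
      using meas_A by (intro prod.cong) (auto simp: emeasure_distr)
    finally show "emeasure ?D (PiE I A) = (\<Prod>i\<in>I. emeasure (borel_of_pmf (p i)) (A i))" .
  qed (simp cong: sets_PiM_cong)
qed

lemma nn_integral_PiM_borel_of_pmf: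
  assumes "finite I" "f \<in> borel_measurable (PiM I (\<lambda>i. borel_of_pmf (p i)))"
  shows "(\<integral>\<^sup>+\<xi>. f \<xi> \<partial>PiM I (\<lambda>i. borel_of_pmf (p i))) =
    (\<integral>\<^sup>+\<xi>. f \<xi> \<partial>measure_pmf (Pi_pmf I undefined p))"
proof -
  have "sets (PiM I (\<lambda>i. borel_of_pmf (p i))) = sets (PiM I (\<lambda>_. borel))"
    by (intro sets_PiM_cong) auto
  then have meas_f: "f \<in> borel_measurable (PiM I (\<lambda>_. borel))"
    using assms(2) by (simp cong: measurable_cong_sets)
  have "(\<integral>\<^sup>+\<xi>. f \<xi> \<partial>PiM I (\<lambda>i. borel_of_pmf (p i))) =
      (\<integral>\<^sup>+\<xi>. f (restrict \<xi> I) \<partial>measure_pmf (Pi_pmf I undefined p))"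
    unfolding PiM_borel_of_pmf[OF \<open>finite I\<close>, symmetric]
    by (rule nn_integral_distr) (auto simp: meas_f space_PiM)
  also have "\<dots> = (\<integral>\<^sup>+\<xi>. f \<xi> \<partial>measure_pmf (Pi_pmf I undefined p))"
    using set_Pi_pmf_subset[OF \<open>finite I\<close>, of undefined p]
    by (intro nn_integral_cong_AE) (auto simp: AE_measure_pmf_iff fun_eq_iff intro!: arg_cong[of _ _ f])
  finally show ?thesis .
qed

lemma nn_integral_pair_PiM_borel_of_pmf:
  assumes "finite I" "sigma_finite_measure R"
    and meas_f: "f \<in> borel_measurable (PiM I (\<lambda>i. borel_of_pmf (p i)) \<Otimes>\<^sub>M R)"
  shows "(\<integral>\<^sup>+z. f z \<partial>(PiM I (\<lambda>i. borel_of_pmf (p i)) \<Otimes>\<^sub>M R)) =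
    (\<integral>\<^sup>+\<xi>. \<integral>\<^sup>+r. f (\<xi>, r) \<partial>R \<partial>measure_pmf (Pi_pmf I undefined p))"
proof -
  interpret R: sigma_finite_measure R by fact
  show ?thesis
    using R.nn_integral_fst[OF meas_f] R.borel_measurable_nn_integral_fst[OF meas_f]
    by (simp add: nn_integral_PiM_borel_of_pmf[OF \<open>finite I\<close>, symmetric])
qed

lemma nn_integral_joint:
  fixes p :: "'a pmf" and N :: "nat \<Rightarrow> real pmf" and \<Phi> :: "'a \<Rightarrow> (nat \<Rightarrow> real) \<times> (nat \<Rightarrow> nat \<Rightarrow> real)"
    and R :: "real measure" and T :: nat
  defines "A \<equiv> distr (measure_pmf p) borel \<Phi>"
  defines "M \<equiv> joint A T (\<lambda>t. borel_of_pmf (N t)) R"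
  assumes fin: "finite (set_pmf p)" "\<And>t. finite (set_pmf (N t))"
    and "prob_space R" and meas_f: "f \<in> borel_measurable M"
  shows "(\<integral>\<^sup>+z. f z \<partial>M) =
    (\<integral>\<^sup>+r. \<integral>\<^sup>+(x, \<xi>). f (\<Phi> x, \<xi>, r) \<partial>pair_pmf p (Pi_pmf {..<T} undefined N) \<partial>R)"
proof -
  let ?P = "PiM {..<T} (\<lambda>t. borel_of_pmf (N t))" and ?\<Xi> = "Pi_pmf {..<T} undefined N"
  interpret R: prob_space R by fact
  interpret P: prob_space ?P
    by (intro prob_space_PiM prob_space_borel_of_pmf)
  interpret PR: pair_prob_space ?P R ..
  have meas_prod: "f \<in> borel_measurable (A \<Otimes>\<^sub>M (?P \<Otimes>\<^sub>M R))"
    using meas_f by (simp add: M_def joint_def)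
  have meas_noise_seed: "(\<lambda>z. f (\<Phi> x, z)) \<in> borel_measurable (?P \<Otimes>\<^sub>M R)" for x
    by (rule measurable_Pair2[OF meas_prod]) (simp add: A_def)
  have set_noise: "set_pmf ?\<Xi> \<subseteq> space ?P"
    using set_Pi_pmf_subset[of "{..<T}" undefined N] by (auto simp: space_PiM PiE_def extensional_def)
  have meas_seed: "(\<lambda>r. f (\<Phi> x, \<xi>, r)) \<in> borel_measurable R" if "\<xi> \<in> set_pmf ?\<Xi>" for x \<xi>
    using measurable_Pair2[OF meas_noise_seed[of x], of \<xi>] that set_noise by auto
  have fin_noise: "finite (set_pmf ?\<Xi>)"
    using fin by (simp add: finite_set_Pi_pmf)
  have "(\<integral>\<^sup>+z. f z \<partial>M) = (\<integral>\<^sup>+a. \<integral>\<^sup>+z. f (a, z) \<partial>(?P \<Otimes>\<^sub>M R) \<partial>A)"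
    unfolding M_def joint_def by (rule PR.nn_integral_fst[OF meas_prod, symmetric])
  also have "\<dots> = (\<integral>\<^sup>+x. \<integral>\<^sup>+z. f (\<Phi> x, z) \<partial>(?P \<Otimes>\<^sub>M R) \<partial>measure_pmf p)"
    using PR.borel_measurable_nn_integral_fst[OF meas_prod] unfolding A_def
    by (subst nn_integral_distr) auto
  also have "\<dots> = (\<integral>\<^sup>+x. \<integral>\<^sup>+\<xi>. \<integral>\<^sup>+r. f (\<Phi> x, \<xi>, r) \<partial>R \<partial>?\<Xi> \<partial>measure_pmf p)"
    by (simp add: nn_integral_pair_PiM_borel_of_pmf meas_noise_seed R.sigma_finite_measure_axioms)
  also have "\<dots> = (\<integral>\<^sup>+(x, \<xi>). \<integral>\<^sup>+r. f (\<Phi> x, \<xi>, r) \<partial>R \<partial>pair_pmf p ?\<Xi>)"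
    by (simp add: nn_integral_pair_pmf')
  also have "\<dots> = (\<integral>\<^sup>+r. \<integral>\<^sup>+(x, \<xi>). f (\<Phi> x, \<xi>, r) \<partial>pair_pmf p ?\<Xi> \<partial>R)"
    unfolding case_prod_unfold using fin fin_noise meas_seed
    by (intro nn_integral_measure_pmf_commute) auto
  finally show ?thesis .
qed

text \<open>\<open>\<kappa>\<close> is a Lagrange multiplier for the query budget, which binds only on average over the seed.\<close>

lemma exp_regret_ge:
  fixes p :: "'a pmf" and N :: "nat \<Rightarrow> real pmf" and \<Phi> :: "'a \<Rightarrow> (nat \<Rightarrow> real) \<times> (nat \<Rightarrow> nat \<Rightarrow> real)"
  defines "A \<equiv> distr (measure_pmf p) borel \<Phi>" and "N' \<equiv> \<lambda>t. borel_of_pmf (N t)"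
  assumes fin: "finite (set_pmf p)" "\<And>t. finite (set_pmf (N t))"
    and "prob_space R" and meas: "measurable_learner d T A N' R pred qry"
    and budget: "exp_queries d T A N' R qry \<le> ennreal B" "0 \<le> B" "0 \<le> \<kappa>"
    and seed: "\<And>r. v \<le> measure_pmf.expectation (pair_pmf p (Pi_pmf {..<T} undefined N)) (\<lambda>(x, \<xi>).
      let (\<theta>, X) = \<Phi> x; Y = labels d \<theta> X \<xi>
      in regret d T pred qry r \<theta> X Y + \<kappa> * real (nqueries T qry r X Y))"
  shows "ennreal (v - \<kappa> * B) \<le> exp_regret d T A N' R pred qry"
proof -
  interpret R: prob_space R by fact
  let ?M = "joint A T N' R" and ?S = "pair_pmf p (Pi_pmf {..<T} undefined N)"
  define reg where "reg z = (case z of ((\<theta>, X), \<xi>, r) \<Rightarrow>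
    regret d T pred qry r \<theta> X (labels d \<theta> X \<xi>))" for z
  define nq where "nq z = (case z of ((\<theta>, X), \<xi>, r) \<Rightarrow>
    real (nqueries T qry r X (labels d \<theta> X \<xi>)))" for z
  have [measurable]: "reg \<in> borel_measurable ?M" "nq \<in> borel_measurable ?M"
    using meas by (simp_all add: measurable_learner_def reg_def[abs_def] nq_def[abs_def])
  have nonneg: "0 \<le> reg z" "0 \<le> nq z" for z
    by (auto simp: reg_def nq_def regret_def split: prod.splits intro: sum_nonneg)
  have "ennreal v \<le> (\<integral>\<^sup>+(x, \<xi>). ennreal (reg (\<Phi> x, \<xi>, r) + \<kappa> * nq (\<Phi> x, \<xi>, r)) \<partial>?S)" for r
  proof -
    have "finite (set_pmf ?S)"
      using fin by (simp add: finite_set_Pi_pmf)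
    then have "(\<integral>\<^sup>+(x, \<xi>). ennreal (reg (\<Phi> x, \<xi>, r) + \<kappa> * nq (\<Phi> x, \<xi>, r)) \<partial>?S) =
        ennreal (measure_pmf.expectation ?S (\<lambda>(x, \<xi>). reg (\<Phi> x, \<xi>, r) + \<kappa> * nq (\<Phi> x, \<xi>, r)))"
      using nonneg budget unfolding case_prod_unfold
      by (intro nn_integral_eq_integral integrable_measure_pmf_finite) auto
    then show ?thesis
      using seed[of r] by (simp add: reg_def nq_def Let_def case_prod_unfold ennreal_leI)
  qed
  then have "ennreal v \<le> (\<integral>\<^sup>+r. \<integral>\<^sup>+(x, \<xi>). ennreal (reg (\<Phi> x, \<xi>, r) + \<kappa> * nq (\<Phi> x, \<xi>, r)) \<partial>?S \<partial>R)"
    using nn_integral_mono[of R "\<lambda>_. ennreal v"] by (simp add: R.emeasure_space_1)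
  also have "\<dots> = (\<integral>\<^sup>+z. ennreal (reg z + \<kappa> * nq z) \<partial>?M)"
    using fin \<open>prob_space R\<close> unfolding A_def N'_def
    by (intro nn_integral_joint[symmetric]) (auto simp flip: A_def N'_def)
  also have "\<dots> = (\<integral>\<^sup>+z. ennreal (reg z) \<partial>?M) + ennreal \<kappa> * (\<integral>\<^sup>+z. ennreal (nq z) \<partial>?M)"
    using nonneg budget by (simp add: ennreal_plus ennreal_mult nn_integral_add nn_integral_cmult)
  also have "\<dots> \<le> exp_regret d T A N' R pred qry + ennreal \<kappa> * ennreal B"
    using budget
    by (intro add_mono mult_left_mono) (auto simp: exp_queries_def exp_regret_def reg_def nq_def)
  finally show ?thesis
    using budget
    by (simp add: ennreal_mult[symmetric] ennreal_minus[symmetric] ennreal_minus_le_iff add.commute)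
qed

section \<open>Lattice noise\<close>

text \<open>Moving this law up or down by half a lattice step, which is \<open>1 / sqrt (real (Suc n))\<close>, produces
  two laws on one common lattice, namely a binomial law and its shift by one.\<close>

definition lattice_noise :: "nat \<Rightarrow> real pmf" where
  "lattice_noise n =
    map_pmf (\<lambda>k. (2 * real k - real n) / sqrt (real (Suc n))) (binomial_pmf n (1/2))"

lemma finite_set_lattice_noise: "finite (set_pmf (lattice_noise n))"
  by (simp add: lattice_noise_def)

lemma expectation_binomial_pmf_half:
  "measure_pmf.expectation (binomial_pmf n (1/2)) f = (\<Sum>k\<le>n. real (n choose k) * f k) / 2 ^ n"
proof -
  have "(1/2::real) ^ k * (1 - 1/2) ^ (n - k) = 1 / 2 ^ n" if "k \<le> n" for k
    using that by (simp add: power_add[symmetric] power_one_over)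
  then show ?thesis
    by (subst expectation_binomial_pmf')
      (auto simp: sum_divide_distrib mult.assoc mult.left_commute intro!: sum.cong)
qed

lemma cosh_le_exp_square: "cosh (x::real) \<le> exp (x\<^sup>2 / 2)"
proof -
  have "cosh y \<le> exp (y\<^sup>2 / 2)" if "0 < y" for y :: real
  proof -
    let ?f = "\<lambda>b. if b then 1 else - 1 :: real"
    interpret interval_bounded_random_variable "measure_pmf (bernoulli_pmf (1/2))" ?f "-1" 1
      by unfold_locales auto
    have "ennreal (cosh y) = (\<integral>\<^sup>+b. ennreal (exp (y * ?f b)) \<partial>bernoulli_pmf (1/2))"
      by (subst nn_integral_eq_integral)
        (auto simp: integrable_measure_pmf_finite cosh_field_def add_divide_distrib)
    also have "\<dots> \<le> ennreal (exp (y\<^sup>2 * (1 - - 1)\<^sup>2 / 8))"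
      using Hoeffdings_lemma_nn_integral[OF \<open>0 < y\<close>] by simp
    finally show ?thesis
      by simp
  qed
  from this[of x] this[of "- x"] show ?thesis
    by (cases "x = 0") (auto simp: neq_iff)
qed

lemma expectation_exp_lattice_noise:
  "measure_pmf.expectation (lattice_noise n) (\<lambda>x. exp (l * x)) = cosh (l / sqrt (real (Suc n))) ^ n"
proof -
  define e where "e = l / sqrt (real (Suc n))"
  have term_eq: "exp (e * (2 * real k - real n)) = exp e ^ k * exp (- e) ^ (n - k)" if "k \<le> n" for k
  proof -
    have "e * (2 * real k - real n) = real k * e + real (n - k) * - e"
      using that by (simp add: of_nat_diff algebra_simps)
    then show ?thesis
      by (simp only: exp_add exp_of_nat_mult)
  qed
  have "measure_pmf.expectation (lattice_noise n) (\<lambda>x. exp (l * x)) =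
      (\<Sum>k\<le>n. real (n choose k) * exp (e * (2 * real k - real n))) / 2 ^ n"
    by (simp add: lattice_noise_def expectation_binomial_pmf_half e_def)
  also have "\<dots> = (exp e + exp (- e)) ^ n / 2 ^ n"
    by (simp add: binomial_ring term_eq mult.assoc)
  also have "\<dots> = cosh e ^ n"
    by (simp add: cosh_field_def power_divide)
  finally show ?thesis
    by (simp only: e_def)
qed

lemma expectation_lattice_noise: "measure_pmf.expectation (lattice_noise n) (\<lambda>x. x) = 0"
proof -
  have "(\<Sum>k\<le>n. real k * real (n choose k)) = real n * 2 ^ (n - 1)"
    "(\<Sum>k\<le>n. real (n choose k)) = 2 ^ n"
    using arg_cong[OF choose_linear_sum[of n], of real] arg_cong[OF choose_row_sum[of n], of real]
    by simp_all
  moreover have "(\<Sum>k\<le>n. real (n choose k) * (2 * real k - real n)) =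
      2 * (\<Sum>k\<le>n. real k * real (n choose k)) - real n * (\<Sum>k\<le>n. real (n choose k))"
    by (simp add: sum_distrib_left sum_subtractf algebra_simps)
  ultimately have "(\<Sum>k\<le>n. real (n choose k) * (2 * real k - real n)) = 0"
    by (cases n) simp_all
  then show ?thesis
    by (simp add: lattice_noise_def expectation_binomial_pmf_half sum_divide_distrib[symmetric])
qed

lemma subgaussian_lattice_noise:
  assumes "1 \<le> \<eta>"
  shows "subgaussian (borel_of_pmf (lattice_noise n)) \<eta>"
proof -
  have "cosh (l / sqrt (real (Suc n))) ^ n \<le> exp (l\<^sup>2 * \<eta>\<^sup>2 / 2)" for l
  proof -
    have "cosh (l / sqrt (real (Suc n))) ^ n \<le> exp ((l / sqrt (real (Suc n)))\<^sup>2 / 2) ^ n"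
      by (intro power_mono cosh_le_exp_square) (simp add: cosh_real_nonneg)
    also have "\<dots> = exp (real n / real (Suc n) * (l\<^sup>2 / 2))"
      by (simp add: exp_of_nat_mult[symmetric] power_divide)
    also have "real n / real (Suc n) * (l\<^sup>2 / 2) \<le> \<eta>\<^sup>2 * (l\<^sup>2 / 2)"
    proof (rule mult_right_mono)
      have "real n / real (Suc n) \<le> 1" "1 \<le> \<eta>\<^sup>2"
        using assms by simp_all
      then show "real n / real (Suc n) \<le> \<eta>\<^sup>2"
        by linarith
    qed simp
    finally show ?thesis
      by (simp add: mult.commute)
  qed
  then show ?thesis
    unfolding subgaussian_def
    by (auto simp: prob_space_borel_of_pmf integrable_distr_eq integral_distr expectation_exp_lattice_noise
        expectation_lattice_noise intro!: integrable_measure_pmf_finite finite_set_lattice_noise)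
qed

lemma geometric_mean_consecutive_choose_ge:
  assumes "i \<le> n"
  shows "2 * real (Suc n) / real (n + 2) * real (n choose i) \<le>
    sqrt (real (Suc n choose i) * real (Suc n choose Suc i))"
proof -
  define u v w where "u = real (Suc n - i)" and "v = real (Suc i)"
    and "w = real (Suc n) * real (n choose i)"
  have pos: "0 < u" "0 < v" and sum_eq: "u + v = real (n + 2)"
    using assms by (auto simp: u_def v_def of_nat_diff)
  have "real (Suc n choose i) * u = w" "real (Suc n choose Suc i) * v = w"
    unfolding u_def v_def w_def of_nat_mult[symmetric]
    using binomial_absorb_comp[of "Suc n" i] Suc_times_binomial_eq[of n i]
    by (simp_all add: mult.commute)
  then have choose_eq: "real (Suc n choose i) = w / u" "real (Suc n choose Suc i) = w / v"
    using pos by (simp_all add: field_simps)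
  \<comment> \<open>The harmonic mean of \<open>w / u\<close> and \<open>w / v\<close> is at most their geometric mean.\<close>
  have "4 * (u * v) \<le> (u + v)\<^sup>2"
    using zero_le_power2[of "u - v"] by (simp add: power2_eq_square algebra_simps)
  then have "4 / (u + v)\<^sup>2 * w\<^sup>2 \<le> 1 / (u * v) * w\<^sup>2"
    using pos by (intro mult_right_mono) (simp_all add: field_simps)
  then have "2 * w / (u + v) \<le> sqrt (w / u * (w / v))"
    by (intro real_le_rsqrt) (simp add: power2_eq_square)
  moreover have "2 * real (Suc n) / real (n + 2) * real (n choose i) = 2 * w / (u + v)"
    unfolding sum_eq by (simp add: w_def)
  ultimately show ?thesis
    unfolding choose_eq by simp
qed

lemma hellinger_affinity_binomial_shift:
  "1 - 1 / real (Suc n) \<le>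
    hellinger_affinity (map_pmf Suc (binomial_pmf n (1/2))) (binomial_pmf n (1/2))"
proof (cases n)
  case 0
  then show ?thesis by (simp add: hellinger_affinity_def)
next
  case (Suc M)
  let ?p = "binomial_pmf n (1/2)"
  have pmf_half: "pmf ?p i = real (n choose i) / 2 ^ n" for i
  proof (cases "i \<le> n")
    case True
    then show ?thesis
      by (simp add: power_add[symmetric] power_one_over mult.assoc)
  qed (simp add: binomial_eq_0)
  have "1 - 1 / real (Suc n) = real (Suc M) / real (M + 2)"
    by (simp add: Suc field_simps)
  also have "\<dots> = 2 * real (Suc M) / real (M + 2) * (\<Sum>i\<le>M. real (M choose i)) / 2 ^ n"
    using arg_cong[OF choose_row_sum[of M], of real] by (simp add: Suc del: of_nat_Suc of_nat_add)
  also have "\<dots> = (\<Sum>i\<le>M. 2 * real (Suc M) / real (M + 2) * real (M choose i) / 2 ^ n)"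
    by (simp only: sum_distrib_left sum_divide_distrib)
  also have "\<dots> \<le> (\<Sum>i\<le>M. sqrt (real (n choose i) * real (n choose Suc i)) / 2 ^ n)"
    unfolding Suc by (intro sum_mono divide_right_mono geometric_mean_consecutive_choose_ge) auto
  also have "\<dots> = (\<Sum>i\<le>M. sqrt (pmf ?p i * pmf ?p (Suc i)))"
    by (simp add: pmf_half real_sqrt_mult real_sqrt_divide)
  also have "\<dots> \<le> (\<Sum>i\<le>n. sqrt (pmf ?p i * pmf ?p (Suc i)))"
    by (intro sum_mono2) (auto simp: Suc)
  also have "\<dots> = hellinger_affinity (map_pmf Suc ?p) ?p"
    by (simp add: hellinger_affinity_def sum.reindex pmf_map_inj')
  finally show ?thesis .
qed

lemma hellinger_affinity_lattice_noise:
  fixes n :: nat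
  defines "a \<equiv> 1 / sqrt (real (Suc n))"
  shows "1 - 1 / real (Suc n) \<le>
    hellinger_affinity (map_pmf ((+) a) (lattice_noise n)) (map_pmf ((+) (- a)) (lattice_noise n))"
proof -
  let ?g = "\<lambda>j. (2 * real j - real (Suc n)) / sqrt (real (Suc n))"
  have "a + (2 * real k - real n) / sqrt (real (Suc n)) = ?g (Suc k)"
    "- a + (2 * real k - real n) / sqrt (real (Suc n)) = ?g k" for k
    by (simp_all add: a_def add_divide_distrib diff_divide_distrib)
  then have "map_pmf ((+) a) (lattice_noise n) = map_pmf ?g (map_pmf Suc (binomial_pmf n (1/2)))"
    "map_pmf ((+) (- a)) (lattice_noise n) = map_pmf ?g (binomial_pmf n (1/2))"
    by (simp_all only: lattice_noise_def pmf.map_comp o_def)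
  moreover have "inj ?g"
    by (auto simp: inj_def)
  ultimately show ?thesis
    using hellinger_affinity_binomial_shift by (simp only: hellinger_affinity_map_inj)
qed

section \<open>The adversary\<close>

lemma AE_distr_measure_pmf_finite:
  fixes \<Phi> :: "'a \<Rightarrow> 'b::t1_space"
  assumes "finite (set_pmf p)" "\<And>x. x \<in> set_pmf p \<Longrightarrow> P (\<Phi> x)"
  shows "AE y in distr (measure_pmf p) borel \<Phi>. P y"
proof -
  have "\<Phi> ` set_pmf p \<in> sets borel"
    using assms by (intro borel_closed finite_imp_closed) simp
  then have "AE y in distr (measure_pmf p) borel \<Phi>. y \<in> \<Phi> ` set_pmf p"
    by (subst AE_distr_iff) (auto simp: AE_measure_pmf_iff)
  then show ?thesis
    by eventually_elim (use assms in auto)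
qed

lemma norm_d_le_sqrt:
  assumes "\<And>i. i < d \<Longrightarrow> \<bar>v i\<bar> \<le> 1"
  shows "norm_d d v \<le> sqrt (real d)"
proof -
  have "(\<Sum>i<d. (v i)\<^sup>2) \<le> (\<Sum>i<d. 1)"
    using assms by (intro sum_mono) (simp add: abs_square_le_1)
  then show ?thesis
    by (simp add: norm_d_def)
qed

context sign_design
begin

definition adversary :: "((nat \<Rightarrow> real) \<times> (nat \<Rightarrow> nat \<Rightarrow> real)) measure" where
  "adversary = distr (measure_pmf prior) borel (\<lambda>J. (sign_vec D a J, inputs))"

definition noise_law :: "nat \<Rightarrow> real measure" where
  "noise_law t = borel_of_pmf (noise (c t))"

lemma prob_space_adversary: "prob_space adversary"
  unfolding adversary_def by (rule prob_space.prob_space_distr[OF prob_space_measure_pmf]) simp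

lemma sets_adversary: "sets adversary = sets borel"
  by (simp add: adversary_def)

lemma AE_adversary:
  "AE (\<theta>, X) in adversary. in_Rd d \<theta> \<and> norm_d d \<theta> \<le> sqrt (real d) \<and>
    (\<forall>t<T. in_Rd d (X t) \<and> norm_d d (X t) \<le> 1 \<and> \<bar>inner_d d \<theta> (X t)\<bar> \<le> 1) \<and> X = inputs"
proof -
  have "\<bar>sign_vec D a J i\<bar> \<le> 1" for J i
    using abs_a_le by (simp add: sign_vec_def)
  moreover have "in_Rd d (inputs t) \<and> norm_d d (inputs t) \<le> 1" if "t < T" for t
    using c_less[OF that] D_le by (simp add: inputs_def in_Rd_basis_vec norm_d_basis_vec_le)
  moreover have "in_Rd d (sign_vec D a J)" for J
    using D_le by (simp add: in_Rd_def sign_vec_def)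
  ultimately show ?thesis
    unfolding adversary_def
    by (intro AE_distr_measure_pmf_finite finite_prior) (simp add: inner_d_inputs norm_d_le_sqrt)
qed

lemma exp_regret_adversary_ge:
  assumes loss_le: "\<And>i. i < D \<Longrightarrow> real (card (rounds i)) * (a i)\<^sup>2 * \<delta> i \<le> \<kappa>"
    and "0 \<le> \<kappa>" "0 \<le> B"
    and "prob_space R" "measurable_learner d T adversary noise_law R pred qry"
      "exp_queries d T adversary noise_law R qry \<le> ennreal B"
  shows "ennreal ((\<Sum>i<D. real (card (rounds i)) * (a i)\<^sup>2) - 2 * \<kappa> * B)
    \<le> exp_regret d T adversary noise_law R pred qry"
  using assms bayes_risk_noise_ge[OF loss_le] unfolding adversary_def noise_law_def[abs_def]
  by (intro exp_regret_ge) (auto simp: finite_prior finite_noise Let_def)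

end

lemma sum_squared_le_sum_divide:
  fixes w k :: "'a \<Rightarrow> real"
  assumes "\<And>i. i \<in> I \<Longrightarrow> 0 < k i"
  shows "(\<Sum>i\<in>I. w i)\<^sup>2 \<le> (\<Sum>i\<in>I. (w i)\<^sup>2 / k i) * (\<Sum>i\<in>I. k i)"
proof -
  have "(\<Sum>i\<in>I. w i)\<^sup>2 = (\<Sum>i\<in>I. w i / sqrt (k i) * sqrt (k i))\<^sup>2"
    using assms by (intro arg_cong[of _ _ "\<lambda>x. x\<^sup>2"] sum.cong) (auto dest: less_imp_neq[OF assms])
  also have "\<dots> \<le> (\<Sum>i\<in>I. (w i / sqrt (k i))\<^sup>2) * (\<Sum>i\<in>I. (sqrt (k i))\<^sup>2)"
    by (rule Cauchy_Schwarz_ineq_sum)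
  also have "\<dots> = (\<Sum>i\<in>I. (w i)\<^sup>2 / k i) * (\<Sum>i\<in>I. k i)"
    using assms by (simp add: power_divide less_imp_le cong: sum.cong)
  finally show ?thesis .
qed

lemma lattice_resolution_exists:
  fixes v :: "nat \<Rightarrow> real" and D :: nat and B :: real
  defines "s \<equiv> \<Sum>i<D. sqrt (v i)"
  assumes v_nonneg: "\<And>i. 0 \<le> v i" and s_pos: "0 < s" and D_le_B: "real D \<le> B"
  obtains n \<kappa> where "0 \<le> \<kappa>" "\<And>i. v i / (real (Suc (n i)))\<^sup>2 \<le> \<kappa>"
    "3 / 40 * s\<^sup>2 / B \<le> (\<Sum>i<D. v i / real (Suc (n i))) - 2 * \<kappa> * B"
proof -
  have "D \<noteq> 0"
    using s_pos by (cases D) (simp_all add: s_def)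
  then have B_pos: "0 < B"
    using D_le_B by simp
  define n where "n i = nat \<lfloor>4 * B / s * sqrt (v i)\<rfloor>" for i
  define \<kappa> where "\<kappa> = (s / (4 * B))\<^sup>2"
  let ?K = "\<lambda>i. real (Suc (n i))"
  have K_ge: "4 * B / s * sqrt (v i) \<le> ?K i" and K_le: "?K i \<le> 4 * B / s * sqrt (v i) + 1" for i
  proof -
    have "0 \<le> 4 * B / s * sqrt (v i)"
      using B_pos s_pos v_nonneg[of i] by simp
    then show "4 * B / s * sqrt (v i) \<le> ?K i" "?K i \<le> 4 * B / s * sqrt (v i) + 1"
      unfolding n_def by linarith+
  qed
  have ratio_le: "v i / (?K i)\<^sup>2 \<le> \<kappa>" for i
  proof -
    have "(sqrt (v i) / ?K i)\<^sup>2 \<le> \<kappa>"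
      unfolding \<kappa>_def using K_ge[of i] v_nonneg[of i] B_pos s_pos
      by (intro power_mono) (simp_all add: field_simps)
    then show ?thesis
      using v_nonneg[of i] by (simp add: power_divide)
  qed
  have "(\<Sum>i<D. ?K i) \<le> 4 * B / s * s + real D"
    using sum_mono[of "{..<D}" ?K, OF K_le] by (simp add: sum.distrib sum_distrib_left s_def)
  also have "\<dots> \<le> 5 * B"
    using D_le_B s_pos by simp
  finally have "(\<Sum>i<D. v i / ?K i) * (\<Sum>i<D. ?K i) \<le> (\<Sum>i<D. v i / ?K i) * (5 * B)"
    by (intro mult_left_mono sum_nonneg) (simp_all add: v_nonneg)
  then have "s\<^sup>2 \<le> (\<Sum>i<D. v i / ?K i) * (5 * B)"
    using sum_squared_le_sum_divide[of "{..<D}" ?K "\<lambda>i. sqrt (v i)"] v_nonneg by (simp add: s_def)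
  then have "s\<^sup>2 / (5 * B) \<le> (\<Sum>i<D. v i / ?K i)"
    using B_pos by (simp add: divide_le_eq)
  moreover have "3 / 40 * s\<^sup>2 / B = s\<^sup>2 / (5 * B) - 2 * \<kappa> * B"
    using B_pos by (simp add: \<kappa>_def power2_eq_square field_simps)
  ultimately show thesis
    using that[of \<kappa> n] ratio_le by (simp add: \<kappa>_def)
qed

lemma hard_adversary_exists:
  fixes d D T :: nat and c :: "nat \<Rightarrow> nat" and B \<eta> :: real
  defines "s \<equiv> \<Sum>i<D. sqrt (card {t \<in> {..<T}. c t = i})"
  assumes "1 \<le> \<eta>" "D \<le> d" and c_less: "\<And>t. t < T \<Longrightarrow> c t < D" and "0 < T" "real D \<le> B"
  obtains A N where "prob_space A" "sets A = sets borel" "\<And>t. subgaussian (N t) \<eta>"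
    "AE (\<theta>, X) in A. in_Rd d \<theta> \<and> norm_d d \<theta> \<le> sqrt (real d) \<and>
      (\<forall>t<T. in_Rd d (X t) \<and> norm_d d (X t) \<le> 1 \<and> \<bar>inner_d d \<theta> (X t)\<bar> \<le> 1) \<and>
      X = (\<lambda>t. basis_vec (c t))"
    "\<And>R pred qry. prob_space R \<Longrightarrow> measurable_learner d T A N R pred qry \<Longrightarrow>
      exp_queries d T A N R qry \<le> ennreal B \<Longrightarrow>
      ennreal (3 / 40 * s\<^sup>2 / B) \<le> exp_regret d T A N R pred qry"
proof -
  have "c 0 < D" "0 \<in> {t \<in> {..<T}. c t = c 0}"
    using c_less \<open>0 < T\<close> by auto
  then have "0 < s"
    unfolding s_def by (intro sum_pos2[of _ "c 0"]) (auto simp: card_gt_0_iff)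
  obtain n \<kappa> where "0 \<le> \<kappa>"
    and ratio_le: "\<And>i. real (card {t \<in> {..<T}. c t = i}) / (real (Suc (n i)))\<^sup>2 \<le> \<kappa>"
    and bound: "3 / 40 * s\<^sup>2 / B \<le>
      (\<Sum>i<D. real (card {t \<in> {..<T}. c t = i}) / real (Suc (n i))) - 2 * \<kappa> * B"
    by (rule lattice_resolution_exists[of "\<lambda>i. real (card {t \<in> {..<T}. c t = i})" D B])
      (use \<open>0 < s\<close> \<open>real D \<le> B\<close> in \<open>auto simp: s_def\<close>)
  interpret sign_design d D T c "\<lambda>i. 1 / sqrt (real (Suc (n i)))" "\<lambda>i. 1 / real (Suc (n i))"
      "\<lambda>i. lattice_noise (n i)"
    by unfold_locales (use \<open>D \<le> d\<close> c_less in \<open>simp_all add: finite_set_lattice_noise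
      hellinger_affinity_lattice_noise del: of_nat_Suc\<close>)
  show thesis
  proof (rule that[of adversary noise_law])
    show "prob_space adversary" "sets adversary = sets borel"
      by (rule prob_space_adversary, rule sets_adversary)
    show "subgaussian (noise_law t) \<eta>" for t
      unfolding noise_law_def by (rule subgaussian_lattice_noise) fact
    show "AE (\<theta>, X) in adversary. in_Rd d \<theta> \<and> norm_d d \<theta> \<le> sqrt (real d) \<and>
        (\<forall>t<T. in_Rd d (X t) \<and> norm_d d (X t) \<le> 1 \<and> \<bar>inner_d d \<theta> (X t)\<bar> \<le> 1) \<and>
        X = (\<lambda>t. basis_vec (c t))"
      using AE_adversary by (simp only: inputs_def[abs_def])
    fix R pred qry
    assume learner: "prob_space R" "measurable_learner d T adversary noise_law R pred qry"
      "exp_queries d T adversary noise_law R qry \<le> ennreal B"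
    have "ennreal (3 / 40 * s\<^sup>2 / B) \<le>
        ennreal ((\<Sum>i<D. real (card (rounds i)) * (1 / sqrt (real (Suc (n i))))\<^sup>2) - 2 * \<kappa> * B)"
      using bound by (simp add: rounds_def power_divide ennreal_leI)
    also have "\<dots> \<le> exp_regret d T adversary noise_law R pred qry"
      using learner ratio_le \<open>0 \<le> \<kappa>\<close> \<open>real D \<le> B\<close> by (intro exp_regret_adversary_ge)
        (simp_all add: rounds_def power_divide power2_eq_square del: of_nat_Suc)
    finally show "ennreal (3 / 40 * s\<^sup>2 / B) \<le> exp_regret d T adversary noise_law R pred qry" .
  qed
qed

section \<open>Assigning rounds to coordinates\<close>

lemma le_card_residue_class:
  fixes n k i :: nat
  assumes "i < k" "k \<le> n"
  shows "n \<le> 2 * k * card {j. j < n \<and> j mod k = i}"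
proof -
  have residue_less: "q * k + i < n" if "q < n div k" for q
    using that assms less_eq_div_iff_mult_less_eq[of k "Suc q" n] by simp
  have "(\<lambda>q. q * k + i) ` {..<n div k} \<subseteq> {j. j < n \<and> j mod k = i}"
    using residue_less assms by auto
  then have "card ((\<lambda>q. q * k + i) ` {..<n div k}) \<le> card {j. j < n \<and> j mod k = i}"
    by (intro card_mono) auto
  moreover have "inj_on (\<lambda>q. q * k + i) {..<n div k}"
    using assms by (auto simp: inj_on_def)
  ultimately have "2 * k * (n div k) \<le> 2 * k * card {j. j < n \<and> j mod k = i}"
    by (simp add: card_image)
  moreover have "n \<le> 2 * k * (n div k)"
  proof -
    have "n mod k < k" "1 \<le> n div k"
      using assms by (auto simp: div_greater_zero_iff Suc_le_eq)
    moreover from this(2) have "k * 1 \<le> k * (n div k)"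
      by (intro mult_le_mono2)
    ultimately show ?thesis
      using mult_div_mod_eq[of k n] by linarith
  qed
  ultimately show ?thesis
    by linarith
qed

lemma block_assignment_exists:
  fixes dU TU :: "nat \<Rightarrow> nat" and m :: nat
  defines "T \<equiv> \<Sum>u<m. TU u"
  assumes dims: "\<And>u. u < m \<Longrightarrow> 0 < dU u \<and> dU u \<le> TU u"
  obtains b :: "nat \<Rightarrow> nat \<times> nat" where
    "\<And>t. t < T \<Longrightarrow> b t \<in> (SIGMA u:{..<m}. {..<dU u})"
    "\<And>u. u < m \<Longrightarrow> card {t \<in> {..<T}. fst (b t) = u} = TU u"
    "\<And>u k. u < m \<Longrightarrow> k < dU u \<Longrightarrow> TU u \<le> 2 * dU u * card {t \<in> {..<T}. b t = (u, k)}"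
proof -
  let ?S = "SIGMA u:{..<m}. {..<TU u}"
  have "\<exists>f. bij_betw f {..<T} ?S"
    by (intro finite_same_card_bij) (simp_all add: T_def)
  then obtain f where bij_f: "bij_betw f {..<T} ?S"
    by blast
  define b where "b t = (fst (f t), snd (f t) mod dU (fst (f t)))" for t
  show thesis
  proof (rule that[of b])
    show "b t \<in> (SIGMA u:{..<m}. {..<dU u})" if "t < T" for t
      using bij_betw_apply[OF bij_f, of t] that dims by (auto simp: b_def)
  next
    fix u assume "u < m"
    have "card {t \<in> {..<T}. fst (b t) = u} = card {z \<in> ?S. fst z = u}"
      by (rule bij_betw_same_card[OF bij_betw_Collect[OF bij_f]]) (simp add: b_def)
    also have "{z \<in> ?S. fst z = u} = {u} \<times> {..<TU u}"
      using \<open>u < m\<close> by auto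
    finally show "card {t \<in> {..<T}. fst (b t) = u} = TU u"
      by simp
    fix k assume "k < dU u"
    have "card {t \<in> {..<T}. b t = (u, k)} = card {z \<in> ?S. fst z = u \<and> snd z mod dU u = k}"
      by (rule bij_betw_same_card[OF bij_betw_Collect[OF bij_f]]) (auto simp: b_def)
    also have "{z \<in> ?S. fst z = u \<and> snd z mod dU u = k} = {u} \<times> {j. j < TU u \<and> j mod dU u = k}"
      using \<open>u < m\<close> by auto
    finally show "TU u \<le> 2 * dU u * card {t \<in> {..<T}. b t = (u, k)}"
      using le_card_residue_class[OF \<open>k < dU u\<close>, of "TU u"] dims[OF \<open>u < m\<close>] by simp
  qed
qed

lemma sum_sqrt_mult_squared_le:
  fixes k l :: "'a \<Rightarrow> nat" and n :: "'a \<times> nat \<Rightarrow> nat"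
  assumes "finite U" and k_pos: "\<And>u. u \<in> U \<Longrightarrow> 0 < k u"
    and l_le: "\<And>u i. u \<in> U \<Longrightarrow> i < k u \<Longrightarrow> l u \<le> 2 * k u * n (u, i)"
  shows "(\<Sum>u\<in>U. sqrt (real (k u) * real (l u)))\<^sup>2 \<le>
    2 * (\<Sum>z\<in>(SIGMA u:U. {..<k u}). sqrt (real (n z)))\<^sup>2"
proof -
  have "sqrt (real (k u) * real (l u)) \<le> sqrt 2 * (\<Sum>i<k u. sqrt (real (n (u, i))))" if "u \<in> U" for u
  proof -
    have "sqrt (real (k u) * real (l u)) \<le> real (k u) * (sqrt 2 * sqrt (real (n (u, i))))"
      if "i < k u" for i
    proof -
      have "k u * l u \<le> (k u)\<^sup>2 * (2 * n (u, i))"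
        using l_le[OF \<open>u \<in> U\<close> that] by (simp add: power2_eq_square mult_ac)
      then have "sqrt (real (k u * l u)) \<le> sqrt (real ((k u)\<^sup>2 * (2 * n (u, i))))"
        by (intro real_sqrt_le_mono of_nat_mono)
      then show ?thesis
        by (simp add: real_sqrt_mult)
    qed
    then have "(\<Sum>i<k u. sqrt (real (k u) * real (l u))) \<le>
        (\<Sum>i<k u. real (k u) * (sqrt 2 * sqrt (real (n (u, i)))))"
      by (intro sum_mono) auto
    then have "real (k u) * sqrt (real (k u) * real (l u)) \<le>
        real (k u) * (sqrt 2 * (\<Sum>i<k u. sqrt (real (n (u, i)))))"
      by (simp add: sum_distrib_left)
    then show ?thesis
      using k_pos[OF \<open>u \<in> U\<close>] by simp
  qed
  then have "(\<Sum>u\<in>U. sqrt (real (k u) * real (l u))) \<le>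
      (\<Sum>u\<in>U. sqrt 2 * (\<Sum>i<k u. sqrt (real (n (u, i)))))"
    by (rule sum_mono)
  also have "\<dots> = sqrt 2 * (\<Sum>z\<in>(SIGMA u:U. {..<k u}). sqrt (real (n z)))"
    using \<open>finite U\<close> by (simp add: sum.Sigma sum_distrib_left case_prod_unfold)
  finally have "(\<Sum>u\<in>U. sqrt (real (k u) * real (l u)))\<^sup>2 \<le>
      (sqrt 2 * (\<Sum>z\<in>(SIGMA u:U. {..<k u}). sqrt (real (n z))))\<^sup>2"
    by (intro power_mono sum_nonneg) auto
  then show ?thesis
    by (simp add: power_mult_distrib)
qed

lemma in_subspace_of_dim_basis_vec:
  assumes K_subset: "K \<subseteq> {..<d}" and card_K: "card K = k" and S_subset: "S \<subseteq> basis_vec ` K"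
  shows "in_subspace_of_dim d k S"
proof -
  have "finite K"
    using K_subset finite_subset by blast
  then obtain e where bij_e: "bij_betw e {..<k} K"
    using ex_bij_betw_nat_finite card_K by (auto simp: atLeast0LessThan)
  have coeff: "(\<Sum>j<k. a j * basis_vec (e j) (e l)) = a l" if "l < k" for a l
  proof -
    have "(\<Sum>j<k. a j * basis_vec (e j) (e l)) = (\<Sum>j<k. if j = l then a l else 0)"
      using that inj_on_eq_iff[OF bij_betw_imp_inj_on[OF bij_e]]
      by (intro sum.cong) (auto simp: basis_vec_def)
    then show ?thesis using that by simp
  qed
  show ?thesis
    unfolding in_subspace_of_dim_def
  proof (intro exI[of _ "\<lambda>j. basis_vec (e j)"] conjI allI impI ballI)
    show "in_Rd d (basis_vec (e j))" if "j < k" for j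
      using bij_betw_apply[OF bij_e] K_subset that by (intro in_Rd_basis_vec) auto
    show "a j = 0" if "\<forall>i. (\<Sum>j<k. a j * basis_vec (e j) i) = 0" "j < k" for a j
      using that coeff[of j a] by simp
    fix x assume "x \<in> S"
    then obtain l where "l < k" "x = basis_vec (e l)"
      using S_subset bij_betw_imp_surj_on[OF bij_e] by blast
    then have "x i = (\<Sum>j<k. (if j = l then 1 else 0) * basis_vec (e j) i)" for i
      by (simp add: if_distrib[of "\<lambda>z. z * _"] cong: if_cong)
    then show "\<exists>a. \<forall>i. x i = (\<Sum>j<k. a j * basis_vec (e j) i)"
      by (intro exI[of _ "\<lambda>j. if j = l then 1 else 0"] allI)
  qed
qed

lemma sum_card_fibres_bij_betw:
  assumes bij_e: "bij_betw e Z W" and b_in: "\<And>t. t \<in> A \<Longrightarrow> b t \<in> Z"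
  shows "(\<Sum>w\<in>W. F (card {t \<in> A. e (b t) = w})) = (\<Sum>z\<in>Z. F (card {t \<in> A. b t = z}))"
proof -
  have "{t \<in> A. e (b t) = e z} = {t \<in> A. b t = z}" if "z \<in> Z" for z
    using inj_on_eq_iff[OF bij_betw_imp_inj_on[OF bij_e]] b_in that by blast
  then show ?thesis
    by (simp add: sum.reindex_bij_betw[OF bij_e, symmetric])
qed

lemma coordinate_assignment_exists:
  fixes dU TU :: "nat \<Rightarrow> nat" and m :: nat
  defines "D \<equiv> \<Sum>u<m. dU u" and "T \<equiv> \<Sum>u<m. TU u"
  assumes dims: "\<And>u. u < m \<Longrightarrow> 0 < dU u \<and> dU u \<le> TU u" and "D \<le> d"
  obtains c I where
    "\<And>t. t < T \<Longrightarrow> c t < D"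
    "\<forall>u<m. I u \<subseteq> {..<T} \<and> I u \<noteq> {} \<and> card (I u) = TU u \<and>
       in_subspace_of_dim d (dU u) ((\<lambda>t. basis_vec (c t)) ` I u)"
    "\<forall>u<m. \<forall>v<m. u \<noteq> v \<longrightarrow> I u \<inter> I v = {}"
    "(\<Union>u<m. I u) = {..<T}"
    "(\<Sum>u<m. sqrt (real (dU u) * real (TU u)))\<^sup>2 \<le>
       2 * (\<Sum>i<D. sqrt (real (card {t \<in> {..<T}. c t = i})))\<^sup>2"
proof -
  obtain b where b_in: "\<And>t. t < T \<Longrightarrow> b t \<in> (SIGMA u:{..<m}. {..<dU u})"
    and card_block: "\<And>u. u < m \<Longrightarrow> card {t \<in> {..<T}. fst (b t) = u} = TU u"
    and card_coordinate:
      "\<And>u k. u < m \<Longrightarrow> k < dU u \<Longrightarrow> TU u \<le> 2 * dU u * card {t \<in> {..<T}. b t = (u, k)}"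
    unfolding T_def by (rule block_assignment_exists[of m dU TU]) (use dims in blast)+
  let ?S = "SIGMA u:{..<m}. {..<dU u}"
  have "\<exists>e. bij_betw e ?S {..<D}"
    by (intro finite_same_card_bij) (simp_all add: D_def)
  then obtain e where bij_e: "bij_betw e ?S {..<D}"
    by blast
  define c where "c t = e (b t)" for t
  define I where "I u = {t \<in> {..<T}. fst (b t) = u}" for u
  show thesis
  proof (rule that[of c I])
    show "c t < D" if "t < T" for t
      using bij_betw_apply[OF bij_e b_in[OF that]] by (simp add: c_def)
    show "\<forall>u<m. I u \<subseteq> {..<T} \<and> I u \<noteq> {} \<and> card (I u) = TU u \<and>
       in_subspace_of_dim d (dU u) ((\<lambda>t. basis_vec (c t)) ` I u)"
    proof (intro allI impI conjI)
      fix u assume "u < m"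
      show "I u \<subseteq> {..<T}" "card (I u) = TU u"
        using card_block[OF \<open>u < m\<close>] by (auto simp: I_def)
      then show "I u \<noteq> {}"
        using dims[OF \<open>u < m\<close>] by auto
      have block_subset: "{u} \<times> {..<dU u} \<subseteq> ?S"
        using \<open>u < m\<close> by auto
      have "e ` ({u} \<times> {..<dU u}) \<subseteq> e ` ?S"
        by (intro image_mono block_subset)
      also have "\<dots> \<subseteq> {..<d}"
        using \<open>D \<le> d\<close> by (simp add: bij_betw_imp_surj_on[OF bij_e])
      finally have "e ` ({u} \<times> {..<dU u}) \<subseteq> {..<d}" .
      moreover have "card (e ` ({u} \<times> {..<dU u})) = dU u"
        using inj_on_subset[OF bij_betw_imp_inj_on[OF bij_e] block_subset] by (simp add: card_image)
      moreover have "(\<lambda>t. basis_vec (c t)) ` I u \<subseteq> basis_vec ` e ` ({u} \<times> {..<dU u})"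
        using b_in by (fastforce simp: I_def c_def)
      ultimately show "in_subspace_of_dim d (dU u) ((\<lambda>t. basis_vec (c t)) ` I u)"
        by (intro in_subspace_of_dim_basis_vec)
    qed
    have "fst (b t) < m" if "t < T" for t
      using b_in[OF that] by auto
    then show "\<forall>u<m. \<forall>v<m. u \<noteq> v \<longrightarrow> I u \<inter> I v = {}" "(\<Union>u<m. I u) = {..<T}"
      by (auto simp: I_def)
    have "(\<Sum>i<D. sqrt (real (card {t \<in> {..<T}. c t = i}))) =
        (\<Sum>z\<in>?S. sqrt (real (card {t \<in> {..<T}. b t = z})))"
      unfolding c_def using bij_e b_in by (intro sum_card_fibres_bij_betw) auto
    then show "(\<Sum>u<m. sqrt (real (dU u) * real (TU u)))\<^sup>2 \<le>
       2 * (\<Sum>i<D. sqrt (real (card {t \<in> {..<T}. c t = i})))\<^sup>2"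
      using dims card_coordinate by (simp only:) (intro sum_sqrt_mult_squared_le, auto)
  qed
qed

theorem theorem3:
  shows "\<exists>c::real. c > 0 \<and>
    (\<forall>(\<eta>::real) (d::nat) (m::nat) (dU::nat \<Rightarrow> nat) (TU::nat \<Rightarrow> nat) (B::nat).
      \<eta> \<ge> 1 \<and> d > 0 \<and> m > 0 \<and> (\<forall>u<m. dU u > 0 \<and> TU u > 0 \<and> dU u \<le> TU u) \<and>
      (\<Sum>u<m. dU u) \<le> d \<and> B \<ge> (\<Sum>u<m. dU u) \<longrightarrow>
      (let T = (\<Sum>u<m. TU u) in
       \<exists>(A :: ((nat \<Rightarrow> real) \<times> (nat \<Rightarrow> nat \<Rightarrow> real)) measure) (N :: nat \<Rightarrow> real measure).
         prob_space A \<and> sets A = sets borel \<and>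
         (\<forall>t<T. subgaussian (N t) \<eta>) \<and>
         (AE (\<theta>, X) in A.
            in_Rd d \<theta> \<and> norm_d d \<theta> \<le> sqrt (real d) \<and>
            (\<forall>t<T. in_Rd d (X t) \<and> norm_d d (X t) \<le> 1 \<and> \<bar>inner_d d \<theta> (X t)\<bar> \<le> 1) \<and>
            (\<exists>I :: nat \<Rightarrow> nat set.
               (\<forall>u<m. I u \<subseteq> {..<T} \<and> I u \<noteq> {} \<and> card (I u) = TU u \<and>
                      in_subspace_of_dim d (dU u) (X ` I u)) \<and>
               (\<forall>u<m. \<forall>v<m. u \<noteq> v \<longrightarrow> I u \<inter> I v = {}) \<and>
               (\<Union>u<m. I u) = {..<T})) \<and>
         (\<forall>(R :: real measure) pred qry.
            prob_space R \<and> sets R = sets borel \<and>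
            measurable_learner d T A N R pred qry \<and>
            exp_queries d T A N R qry \<le> ennreal (real B) \<longrightarrow>
            exp_regret d T A N R pred qry \<ge>
              ennreal (c * (\<Sum>u<m. sqrt (real (dU u) * real (TU u)))\<^sup>2 / real B))))"
proof (intro exI[of _ "3 / 80 :: real"] conjI allI impI, goal_cases)
  case (2 \<eta> d m dU TU B)
  let ?T = "\<Sum>u<m. TU u" and ?D = "\<Sum>u<m. dU u" and ?S = "\<Sum>u<m. sqrt (real (dU u) * real (TU u))"
  obtain c I where c_less: "\<And>t. t < ?T \<Longrightarrow> c t < ?D"
    and blocks: "\<forall>u<m. I u \<subseteq> {..<?T} \<and> I u \<noteq> {} \<and> card (I u) = TU u \<and>
        in_subspace_of_dim d (dU u) ((\<lambda>t. basis_vec (c t)) ` I u)"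
      "\<forall>u<m. \<forall>v<m. u \<noteq> v \<longrightarrow> I u \<inter> I v = {}" "(\<Union>u<m. I u) = {..<?T}"
    and S_le: "?S\<^sup>2 \<le> 2 * (\<Sum>i<?D. sqrt (card {t \<in> {..<?T}. c t = i}))\<^sup>2" (is "_ \<le> 2 * ?s\<^sup>2")
    by (rule coordinate_assignment_exists[of m dU TU d]) (use 2 in auto)
  have "0 < ?T"
    using 2 by (intro sum_pos) auto
  obtain A N where laws: "prob_space A" "sets A = sets borel" "\<And>t. subgaussian (N t) \<eta>"
    and instance_valid: "AE (\<theta>, X) in A. in_Rd d \<theta> \<and> norm_d d \<theta> \<le> sqrt (real d) \<and>
      (\<forall>t<?T. in_Rd d (X t) \<and> norm_d d (X t) \<le> 1 \<and> \<bar>inner_d d \<theta> (X t)\<bar> \<le> 1) \<and>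
      X = (\<lambda>t. basis_vec (c t))"
    and regret_ge: "\<And>R pred qry. prob_space R \<Longrightarrow> measurable_learner d ?T A N R pred qry \<Longrightarrow>
      exp_queries d ?T A N R qry \<le> ennreal (real B) \<Longrightarrow>
      ennreal (3 / 40 * ?s\<^sup>2 / real B) \<le> exp_regret d ?T A N R pred qry"
    by (rule hard_adversary_exists[of \<eta> ?D d ?T c "real B"])
      (use 2 c_less \<open>0 < ?T\<close> in \<open>auto simp del: of_nat_sum\<close>)
  have "ennreal (3 / 80 * ?S\<^sup>2 / real B) \<le> ennreal (3 / 40 * ?s\<^sup>2 / real B)"
    using S_le by (intro ennreal_leI divide_right_mono) auto
  then show ?case
    unfolding Let_def
    by (intro exI[of _ A] exI[of _ N] conjI allI impI laws eventually_mono[OF instance_valid]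
        order.trans[OF _ regret_ge]) (use blocks in auto)
qed simp

end
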